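(* In the system NSA, the principle $\mathbb{LPO}$ is equivalent to the principle $\Pi_1$-TRANS. Here $\mathbb{LPO}$ is: for every $\Sigma_1$-formula $P$, $P \oplus {\sim}P$; and $\Pi_1$-TRANS is: for every $\Delta_0$-formula $\varphi$ (with standard parameters), $(\forall n\in\mathbb{N})\varphi(n)\rightarrow(\forall n\in{}^{*}\mathbb{N}){}^{*}\varphi(n)$.
   Context: Notation: $\mathbb{N}$ standard (finite) numbers, ${}^{*}\mathbb{N}$ nonstandard numbers, $\Omega={}^{*}\mathbb{N}\setminus\mathbb{N}$ infinite numbers; ${}^{*}\varphi$ is the star image of $\varphi$ (often suppressed). A formula is $\Delta_0$ if all quantifiers are bounded by terms and no infinite numbers occur; $\Delta_0$-formulas may contain standard numbers and standard sets as parameters. A $\Sigma_1$-formula is one of the form $(\exists n\in\mathbb{N})\varphi(n)$ with $\varphi$ $\Delta_0$; $\Pi_1$ is $(\forall n\in\mathbb{N})\varphi(n)$. The system s-NSA is multi-sorted (standard numbers in $\mathbb{N}$, nonstandard numbers in ${}^{*}\mathbb{N}$, standard sets $\subseteq\mathbb{N}$, nonstandard sets $\subseteq{}^{*}\mathbb{N}$) with axioms: $I\Sigma_1$ and ${}^{*}I\Sigma_1$; ${}^{*}\mathbb{N}$ is an end extension of $\mathbb{N}$; the standard structure embeds into the nonstandard one via an injective homomorphism; $\Omega$-CA: for $\Delta_0$ $\psi(n,m)$ and $\omega\in\Omega$, if $(\forall n\in\mathbb{N})(\forall\omega'\in\Omega)[{}^{*}\psi(n,\omega)\leftrightarrow{}^{*}\psi(n,\omega')]$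 then $(\exists X\subset\mathbb{N})(\forall n\in\mathbb{N})[{}^{*}\psi(n,\omega)\leftrightarrow n\in X]$; $\Delta_0$-TRANS: $(\forall n\in\mathbb{N})(\forall X\subset\mathbb{N})[\varphi(n,X)\leftrightarrow{}^{*}\varphi(n,X)]$ for $\Delta_0$ $\varphi$; $\Delta_0$-underspill: $(\forall n\in\mathbb{N})(\forall X\subset{}^{*}\mathbb{N})[(\forall\omega\in\Omega){}^{*}\varphi(n,X,\omega)\rightarrow(\exists m\in\mathbb{N})\varphi(n,X,m)]$ for $\Delta_0$ $\varphi$; and the transfer rule (if the system proves $(\forall n\in\mathbb{N})\varphi(n)$ for $\Delta_0$ $\varphi$, it proves $(\forall n\in{}^{*}\mathbb{N}){}^{*}\varphi(n)$). NSA is s-NSA extended with an intermediate level $\mathbb{N}_1$ with $\mathbb{N}\subsetneq\mathbb{N}_1\subsetneq{}^{*}\mathbb{N}$, connected to the other levels by $\Delta_0$-transfer and $\Delta_0$-underspill in the same way as $\mathbb{N}$ and ${}^{*}\mathbb{N}$ are. Elements of $\mathbb{N}_1$ are called 1-finite; $\Omega_1={}^{*}\mathbb{N}\setminus\mathbb{N}_1$. NSA does not include $\Pi_1$-TRANS. $\Omega$-invariance: for $\Delta_0$ $\psi(\vec x,m)$ and fixed $\omega\in\Omega$, $\psi(\vec x,\omega)$ is $\Omega$-invariant if $(\forall\vec x\in\mathbb{N}^k)(\forall\omega'\in\Omega)(\psi(\vec x,\omega)\leftrightarrow\psi(\vec x,\omega'))$. The predicate "$A\in\mathbb{T}$" (for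 $\varphi$ $\Delta_0$): $(\forall n\in\mathbb{N})\varphi(n)\in\mathbb{T}$ is $(\forall n\in\mathbb{N})\varphi(n)\rightarrow(\forall n\in{}^{*}\mathbb{N})\varphi(n)$; $(\exists n\in{}^{*}\mathbb{N})\varphi(n)\in\mathbb{T}$ is $(\exists n\in{}^{*}\mathbb{N})\varphi(n)\rightarrow(\exists n\in\mathbb{N}_1)\varphi(n)$; $(\forall n\in\mathbb{N})(\exists m\in\mathbb{N})\varphi(n,m)\in\mathbb{T}$ is $(\forall n\in\mathbb{N})(\exists m\in\mathbb{N})\varphi(n,m)\rightarrow(\forall n\in{}^{*}\mathbb{N})(\exists m\in{}^{*}\mathbb{N})[m \text{ is } n\text{-finite}\wedge\varphi(n,m)]$; $(\exists n\in{}^{*}\mathbb{N})(\forall m\in{}^{*}\mathbb{N})\varphi(n,m)\in\mathbb{T}$ is $(\exists n\in{}^{*}\mathbb{N})(\forall m\in{}^{*}\mathbb{N})\varphi(n,m)\rightarrow(\exists n\in\mathbb{N}_1)(\forall m\in{}^{*}\mathbb{N})\varphi(n,m)$; for formulas not suitable for transfer, such as $(\exists n\in\mathbb{N})\varphi(n)$, $(\exists n\in\mathbb{N}_1)\varphi(n)$, $0=1$ and $(\forall n\in{}^{*}\mathbb{N})\varphi(n)$, "$A\in\mathbb{T}$" is the trivial formula $0=0$. Hyperconnectives: $A\Rrightarrow B$ is $[A\wedge A\in\mathbb{T}]\rightarrow[B\wedge B\in\mathbb{T}]$; ${\sim}A$ is $A\Rrightarrow 0=1$; for $A,B$ with standard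 parameters $\vec x\in\mathbb{N}^k$, $A\oplus B$ means: there is an $\Omega$-invariant formula $\psi(\vec x,\omega)$ such that $(\forall\vec x\in\mathbb{N}^k)\big(\psi(\vec x,\omega)\rightarrow[A(\vec x)\wedge A(\vec x)\in\mathbb{T}]\ \wedge\ \neg\psi(\vec x,\omega)\rightarrow[B(\vec x)\wedge B(\vec x)\in\mathbb{T}]\big)$. *)

theory Defs
  imports Main
begin

section \<open>Syntax\<close>

text \<open>
  The three levels are \<open>Std\<close> for $\mathbb{N}$, \<open>Fin1\<close> for $\mathbb{N}_1$ and \<open>Star\<close> for
  ${}^{*}\mathbb{N}$.  Each level has a sort of numbers and a sort of sets of numbers.
  Variables are de Bruijn indices, counted separately for every sort: a quantifier of sort
  \<open>s\<close> binds index \<open>0\<close> of sort \<open>s\<close> and leaves the indices of all other sorts alone.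

  The syntax is polymorphic in the level only so that the map functions of the datatypes provide
  the change of level.  The symbols \<open>Emb l l'\<close> and \<open>SEmb l l'\<close> are the embeddings of the numbers and
  of the sets of level \<open>l\<close> into those of level \<open>l'\<close>; the latter sends $X$ to its star image.
  Equality is a relation between numbers only, as usual in second-order arithmetic.  (A primitive
  extensional equality of sets would make the star image of sets respect extensional equality,
  which is a form of transfer for $\Pi_1$ formulas.)
\<close>

datatype level = Std | Fin1 | Star

datatype 'l srt = Num 'l | Sets 'l

datatype 'l tm =
    Var "'l srt" nat
  | Zero 'l
  | One 'l
  | Plus 'l "'l tm" "'l tm"
  | Times 'l "'l tm" "'l tm"
  | Emb 'l 'l "'l tm"
  | SEmb 'l 'l "'l tm"

text \<open>\<open>BAll l t A\<close> and \<open>BEx l t A\<close> are $(\forall n<t)A$ and $(\exists n<t)A$; the variable $n$ is bound in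
  \<open>A\<close> but not in \<open>t\<close>.\<close>

datatype 'l fm =
    Fls
  | Eq 'l "'l tm" "'l tm"
  | Less 'l "'l tm" "'l tm"
  | Mem 'l "'l tm" "'l tm"
  | Imp "'l fm" "'l fm"
  | And "'l fm" "'l fm"
  | Or "'l fm" "'l fm"
  | BAll 'l "'l tm" "'l fm"
  | BEx 'l "'l tm" "'l fm"
  | Forall "'l srt" "'l fm"
  | Exists "'l srt" "'l fm"

type_synonym form = "level fm"
type_synonym trm = "level tm"
type_synonym env = "level srt \<Rightarrow> nat \<Rightarrow> trm"

abbreviation Neg :: "'l fm \<Rightarrow> 'l fm" where
  "Neg A \<equiv> Imp A Fls"

abbreviation Iff :: "'l fm \<Rightarrow> 'l fm \<Rightarrow> 'l fm" where
  "Iff A B \<equiv> And (Imp A B) (Imp B A)"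

abbreviation num :: "'l \<Rightarrow> nat \<Rightarrow> 'l tm" where
  "num l i \<equiv> Var (Num l) i"

abbreviation sv :: "'l \<Rightarrow> nat \<Rightarrow> 'l tm" where
  "sv l i \<equiv> Var (Sets l) i"

definition below :: "level \<Rightarrow> level \<Rightarrow> bool" where
  "below l l' \<longleftrightarrow> (l, l') \<in> {(Std, Fin1), (Std, Star), (Fin1, Star)}"

fun has_srt :: "trm \<Rightarrow> level srt \<Rightarrow> bool" where
  "has_srt (Var s' i) s \<longleftrightarrow> s = s'"
| "has_srt (Zero l) s \<longleftrightarrow> s = Num l"
| "has_srt (One l) s \<longleftrightarrow> s = Num l"
| "has_srt (Plus l t u) s \<longleftrightarrow> s = Num l \<and> has_srt t (Num l) \<and> has_srt u (Num l)"
| "has_srt (Times l t u) s \<longleftrightarrow> s = Num l \<and> has_srt t (Num l) \<and> has_srt u (Num l)"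
| "has_srt (Emb l l' t) s \<longleftrightarrow> below l l' \<and> s = Num l' \<and> has_srt t (Num l)"
| "has_srt (SEmb l l' t) s \<longleftrightarrow> below l l' \<and> s = Sets l' \<and> has_srt t (Sets l)"

fun well_sorted :: "form \<Rightarrow> bool" where
  "well_sorted Fls \<longleftrightarrow> True"
| "well_sorted (Eq l t u) \<longleftrightarrow> has_srt t (Num l) \<and> has_srt u (Num l)"
| "well_sorted (Less l t u) \<longleftrightarrow> has_srt t (Num l) \<and> has_srt u (Num l)"
| "well_sorted (Mem l t u) \<longleftrightarrow> has_srt t (Num l) \<and> has_srt u (Sets l)"
| "well_sorted (Imp A B) \<longleftrightarrow> well_sorted A \<and> well_sorted B"
| "well_sorted (And A B) \<longleftrightarrow> well_sorted A \<and> well_sorted B"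
| "well_sorted (Or A B) \<longleftrightarrow> well_sorted A \<and> well_sorted B"
| "well_sorted (BAll l t A) \<longleftrightarrow> has_srt t (Num l) \<and> well_sorted A"
| "well_sorted (BEx l t A) \<longleftrightarrow> has_srt t (Num l) \<and> well_sorted A"
| "well_sorted (Forall s A) \<longleftrightarrow> well_sorted A"
| "well_sorted (Exists s A) \<longleftrightarrow> well_sorted A"

fun fv_tm :: "'l tm \<Rightarrow> ('l srt \<times> nat) set" where
  "fv_tm (Var s i) = {(s, i)}"
| "fv_tm (Zero l) = {}"
| "fv_tm (One l) = {}"
| "fv_tm (Plus l t u) = fv_tm t \<union> fv_tm u"
| "fv_tm (Times l t u) = fv_tm t \<union> fv_tm u"
| "fv_tm (Emb l l' t) = fv_tm t"
| "fv_tm (SEmb l l' t) = fv_tm t"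

definition unbind :: "'l srt \<Rightarrow> ('l srt \<times> nat) set \<Rightarrow> ('l srt \<times> nat) set" where
  "unbind s V = {(s', i). (s', if s' = s then Suc i else i) \<in> V}"

fun fv :: "'l fm \<Rightarrow> ('l srt \<times> nat) set" where
  "fv Fls = {}"
| "fv (Eq l t u) = fv_tm t \<union> fv_tm u"
| "fv (Less l t u) = fv_tm t \<union> fv_tm u"
| "fv (Mem l t u) = fv_tm t \<union> fv_tm u"
| "fv (Imp A B) = fv A \<union> fv B"
| "fv (And A B) = fv A \<union> fv B"
| "fv (Or A B) = fv A \<union> fv B"
| "fv (BAll l t A) = fv_tm t \<union> unbind (Num l) (fv A)"
| "fv (BEx l t A) = fv_tm t \<union> unbind (Num l) (fv A)"
| "fv (Forall s A) = unbind s (fv A)"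
| "fv (Exists s A) = unbind s (fv A)"

definition sentence :: "form \<Rightarrow> bool" where
  "sentence A \<longleftrightarrow> well_sorted A \<and> fv A = {}"

subsection \<open>Substitution\<close>

fun subst_tm :: "env \<Rightarrow> trm \<Rightarrow> trm" where
  "subst_tm \<sigma> (Var s i) = \<sigma> s i"
| "subst_tm \<sigma> (Zero l) = Zero l"
| "subst_tm \<sigma> (One l) = One l"
| "subst_tm \<sigma> (Plus l t u) = Plus l (subst_tm \<sigma> t) (subst_tm \<sigma> u)"
| "subst_tm \<sigma> (Times l t u) = Times l (subst_tm \<sigma> t) (subst_tm \<sigma> u)"
| "subst_tm \<sigma> (Emb l l' t) = Emb l l' (subst_tm \<sigma> t)"
| "subst_tm \<sigma> (SEmb l l' t) = SEmb l l' (subst_tm \<sigma> t)"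

definition shift_env :: "level srt \<Rightarrow> env" where
  "shift_env s = (\<lambda>s' i. if s' = s then Var s (Suc i) else Var s' i)"

definition shift_tm :: "level srt \<Rightarrow> trm \<Rightarrow> trm" where
  "shift_tm s = subst_tm (shift_env s)"

definition under :: "level srt \<Rightarrow> env \<Rightarrow> env" where
  "under s \<sigma> = (\<lambda>s' i. if s' = s
     then (case i of 0 \<Rightarrow> Var s 0 | Suc j \<Rightarrow> shift_tm s (\<sigma> s j))
     else shift_tm s (\<sigma> s' i))"

fun subst :: "env \<Rightarrow> form \<Rightarrow> form" where
  "subst \<sigma> Fls = Fls"
| "subst \<sigma> (Eq l t u) = Eq l (subst_tm \<sigma> t) (subst_tm \<sigma> u)"
| "subst \<sigma> (Less l t u) = Less l (subst_tm \<sigma> t) (subst_tm \<sigma> u)"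
| "subst \<sigma> (Mem l t u) = Mem l (subst_tm \<sigma> t) (subst_tm \<sigma> u)"
| "subst \<sigma> (Imp A B) = Imp (subst \<sigma> A) (subst \<sigma> B)"
| "subst \<sigma> (And A B) = And (subst \<sigma> A) (subst \<sigma> B)"
| "subst \<sigma> (Or A B) = Or (subst \<sigma> A) (subst \<sigma> B)"
| "subst \<sigma> (BAll l t A) = BAll l (subst_tm \<sigma> t) (subst (under (Num l) \<sigma>) A)"
| "subst \<sigma> (BEx l t A) = BEx l (subst_tm \<sigma> t) (subst (under (Num l) \<sigma>) A)"
| "subst \<sigma> (Forall s A) = Forall s (subst (under s \<sigma>) A)"
| "subst \<sigma> (Exists s A) = Exists s (subst (under s \<sigma>) A)"

definition shift :: "level srt \<Rightarrow> form \<Rightarrow> form" where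
  "shift s = subst (shift_env s)"

text \<open>\<open>inst s t A\<close> is the body \<open>A\<close> of a quantifier of sort \<open>s\<close> with the bound variable replaced by
  \<open>t\<close>, where \<open>t\<close> lives outside the quantifier.\<close>

definition inst :: "level srt \<Rightarrow> trm \<Rightarrow> form \<Rightarrow> form" where
  "inst s t = subst (\<lambda>s' i. if s' = s then (case i of 0 \<Rightarrow> t | Suc j \<Rightarrow> Var s j) else Var s' i)"

subsection \<open>Bounded formulas and star images\<close>

fun arith_tm :: "'l \<Rightarrow> 'l tm \<Rightarrow> bool" where
  "arith_tm l (Var s i) \<longleftrightarrow> s = Num l"
| "arith_tm l (Zero l') \<longleftrightarrow> l' = l"
| "arith_tm l (One l') \<longleftrightarrow> l' = l"
| "arith_tm l (Plus l' t u) \<longleftrightarrow> l' = l \<and> arith_tm l t \<and> arith_tm l u"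
| "arith_tm l (Times l' t u) \<longleftrightarrow> l' = l \<and> arith_tm l t \<and> arith_tm l u"
| "arith_tm l (Emb _ _ _) \<longleftrightarrow> False"
| "arith_tm l (SEmb _ _ _) \<longleftrightarrow> False"

text \<open>\<open>delta0 l A\<close>: \<open>A\<close> is a $\Delta_0$ formula of the language of level \<open>l\<close>.  Its free variables of
  sorts \<open>Num l\<close> and \<open>Sets l\<close> are its arguments and parameters.\<close>

fun delta0 :: "'l \<Rightarrow> 'l fm \<Rightarrow> bool" where
  "delta0 l Fls \<longleftrightarrow> True"
| "delta0 l (Eq l' t u) \<longleftrightarrow> l' = l \<and> arith_tm l t \<and> arith_tm l u"
| "delta0 l (Less l' t u) \<longleftrightarrow> l' = l \<and> arith_tm l t \<and> arith_tm l u"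
| "delta0 l (Mem l' t u) \<longleftrightarrow> l' = l \<and> arith_tm l t \<and> (\<exists>i. u = sv l i)"
| "delta0 l (Imp A B) \<longleftrightarrow> delta0 l A \<and> delta0 l B"
| "delta0 l (And A B) \<longleftrightarrow> delta0 l A \<and> delta0 l B"
| "delta0 l (Or A B) \<longleftrightarrow> delta0 l A \<and> delta0 l B"
| "delta0 l (BAll l' t A) \<longleftrightarrow> l' = l \<and> arith_tm l t \<and> delta0 l A"
| "delta0 l (BEx l' t A) \<longleftrightarrow> l' = l \<and> arith_tm l t \<and> delta0 l A"
| "delta0 l (Forall _ _) \<longleftrightarrow> False"
| "delta0 l (Exists _ _) \<longleftrightarrow> False"

definition sigma1 :: "'l \<Rightarrow> 'l fm \<Rightarrow> bool" where
  "sigma1 l A \<longleftrightarrow> (\<exists>\<phi>. delta0 l \<phi> \<and> A = Exists (Num l) \<phi>)"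

text \<open>For a $\Delta_0$ formula \<open>\<phi>\<close> of level \<open>l\<close>, \<open>star l l' ts \<phi>\<close> is its image at level \<open>l'\<close> in which
  the first \<open>length ts\<close> number variables are replaced by the terms \<open>ts\<close> of level \<open>l'\<close>, while the
  remaining number variables and all set variables become embedded variables of level \<open>l\<close>.\<close>

definition star :: "level \<Rightarrow> level \<Rightarrow> trm list \<Rightarrow> form \<Rightarrow> form" where
  "star l l' ts \<phi> = subst
     (\<lambda>s i. case s of
        Num _ \<Rightarrow> if i < length ts then ts ! i else Emb l l' (num l (i - length ts))
      | Sets _ \<Rightarrow> SEmb l l' (sv l i))
     (map_fm (\<lambda>_. l') \<phi>)"

text \<open>\<open>num_params l l' ts \<phi>\<close>, for \<open>\<phi>\<close> already of level \<open>l'\<close>, treats the number variables in the same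
  way but keeps the set variables, which thus range over arbitrary sets of level \<open>l'\<close>.\<close>

definition num_params :: "level \<Rightarrow> level \<Rightarrow> trm list \<Rightarrow> form \<Rightarrow> form" where
  "num_params l l' ts \<phi> = subst
     (\<lambda>s i. case s of
        Num _ \<Rightarrow> if i < length ts then ts ! i else Emb l l' (num l (i - length ts))
      | Sets _ \<Rightarrow> Var s i)
     \<phi>"

text \<open>\<open>finite_at l l' t\<close>: the number \<open>t\<close> of level \<open>l'\<close> belongs to level \<open>l\<close>.
  So \<open>infinite_at Std Star t\<close> is $t\in\Omega$ and \<open>infinite_at Fin1 Star t\<close> is $t\in\Omega_1$.\<close>

definition finite_at :: "level \<Rightarrow> level \<Rightarrow> trm \<Rightarrow> form" where
  "finite_at l l' t = Exists (Num l) (Eq l' (shift_tm (Num l) t) (Emb l l' (num l 0)))"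

abbreviation infinite_at :: "level \<Rightarrow> level \<Rightarrow> trm \<Rightarrow> form" where
  "infinite_at l l' t \<equiv> Neg (finite_at l l' t)"

section \<open>The system NSA\<close>

text \<open>Free variables of axioms are implicitly universally quantified.\<close>

text \<open>The axioms of a discretely ordered semiring, followed by $\Sigma_1$ induction.\<close>

inductive_set ISigma1 :: "level \<Rightarrow> form set" for l :: level where
  "Eq l (Plus l (Plus l (num l 0) (num l 1)) (num l 2))
        (Plus l (num l 0) (Plus l (num l 1) (num l 2))) \<in> ISigma1 l"
| "Eq l (Plus l (num l 0) (num l 1)) (Plus l (num l 1) (num l 0)) \<in> ISigma1 l"
| "Eq l (Times l (Times l (num l 0) (num l 1)) (num l 2))
        (Times l (num l 0) (Times l (num l 1) (num l 2))) \<in> ISigma1 l"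
| "Eq l (Times l (num l 0) (num l 1)) (Times l (num l 1) (num l 0)) \<in> ISigma1 l"
| "Eq l (Times l (num l 0) (Plus l (num l 1) (num l 2)))
        (Plus l (Times l (num l 0) (num l 1)) (Times l (num l 0) (num l 2))) \<in> ISigma1 l"
| "Eq l (Plus l (num l 0) (Zero l)) (num l 0) \<in> ISigma1 l"
| "Eq l (Times l (num l 0) (Zero l)) (Zero l) \<in> ISigma1 l"
| "Eq l (Times l (num l 0) (One l)) (num l 0) \<in> ISigma1 l"
| "Imp (And (Less l (num l 0) (num l 1)) (Less l (num l 1) (num l 2)))
       (Less l (num l 0) (num l 2)) \<in> ISigma1 l"
| "Neg (Less l (num l 0) (num l 0)) \<in> ISigma1 l"
| "Or (Less l (num l 0) (num l 1))
      (Or (Eq l (num l 0) (num l 1)) (Less l (num l 1) (num l 0))) \<in> ISigma1 l"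
| "Imp (Less l (num l 0) (num l 1))
       (Less l (Plus l (num l 0) (num l 2)) (Plus l (num l 1) (num l 2))) \<in> ISigma1 l"
| "Imp (And (Less l (Zero l) (num l 2)) (Less l (num l 0) (num l 1)))
       (Less l (Times l (num l 0) (num l 2)) (Times l (num l 1) (num l 2))) \<in> ISigma1 l"
| "Imp (Less l (num l 0) (num l 1))
       (Exists (Num l) (Eq l (Plus l (num l 1) (num l 0)) (num l 2))) \<in> ISigma1 l"
| "Less l (Zero l) (One l) \<in> ISigma1 l"
| "Imp (Less l (Zero l) (num l 0))
       (Or (Eq l (One l) (num l 0)) (Less l (One l) (num l 0))) \<in> ISigma1 l"
| "Or (Eq l (Zero l) (num l 0)) (Less l (Zero l) (num l 0)) \<in> ISigma1 l"
| "sigma1 l A \<Longrightarrow>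
   Imp (And (inst (Num l) (Zero l) A)
            (Forall (Num l) (Imp A
              (subst (\<lambda>s i. if s = Num l \<and> i = 0 then Plus l (num l 0) (One l) else Var s i) A))))
       (Forall (Num l) A) \<in> ISigma1 l"

text \<open>The embedding is an injective homomorphism; injectivity on sets (with respect to extensional
  equality) follows from the equivalence for membership.\<close>

inductive_set embedding :: "level \<Rightarrow> level \<Rightarrow> form set" for l l' :: level where
  "Eq l' (Emb l l' (Zero l)) (Zero l') \<in> embedding l l'"
| "Eq l' (Emb l l' (One l)) (One l') \<in> embedding l l'"
| "Eq l' (Emb l l' (Plus l (num l 0) (num l 1)))
         (Plus l' (Emb l l' (num l 0)) (Emb l l' (num l 1))) \<in> embedding l l'"
| "Eq l' (Emb l l' (Times l (num l 0) (num l 1)))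
         (Times l' (Emb l l' (num l 0)) (Emb l l' (num l 1))) \<in> embedding l l'"
| "Imp (Eq l' (Emb l l' (num l 0)) (Emb l l' (num l 1))) (Eq l (num l 0) (num l 1)) \<in> embedding l l'"
| "Iff (Less l (num l 0) (num l 1))
       (Less l' (Emb l l' (num l 0)) (Emb l l' (num l 1))) \<in> embedding l l'"
| "Iff (Mem l (num l 0) (sv l 0))
       (Mem l' (Emb l l' (num l 0)) (SEmb l l' (sv l 0))) \<in> embedding l l'"

definition end_extension :: "level \<Rightarrow> level \<Rightarrow> form" where
  "end_extension l l' = Imp (Less l' (num l' 0) (Emb l l' (num l 0))) (finite_at l l' (num l' 0))"

definition Delta0_TRANS :: "level \<Rightarrow> level \<Rightarrow> form set" where
  "Delta0_TRANS l l' = {Iff \<phi> (star l l' [] \<phi>) | \<phi>. delta0 l \<phi>}"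

definition Delta0_underspill :: "level \<Rightarrow> level \<Rightarrow> form set" where
  "Delta0_underspill l l' =
     {Imp (Forall (Num l') (Imp (infinite_at l l' (num l' 0)) (num_params l l' [num l' 0] \<phi>)))
          (Exists (Num l) (num_params l l' [] \<phi>)) | \<phi>. delta0 l' \<phi>}"

text \<open>In $\psi(\vec x,m)$ the index of $m$ is \<open>0\<close>.  The formula \<open>Omega_invariant k \<psi>\<close> says, of the number
  $\omega$ with index \<open>0\<close>, that $\psi(\vec x,\omega)$ is $\Omega$-invariant, where $\vec x$ has length \<open>k\<close>.\<close>

definition Foralls :: "nat \<Rightarrow> form \<Rightarrow> form" where
  "Foralls k = (Forall (Num Std) ^^ k)"

definition at_omega :: "form \<Rightarrow> form" where
  "at_omega \<psi> = star Std Star [num Star 0] \<psi>"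

definition Omega_invariant :: "nat \<Rightarrow> form \<Rightarrow> form" where
  "Omega_invariant k \<psi> =
     Foralls k (Forall (Num Star) (Imp (infinite_at Std Star (num Star 0))
       (Iff (shift (Num Star) (at_omega \<psi>)) (at_omega \<psi>))))"

definition Omega_CA :: "form set" where
  "Omega_CA =
     {Forall (Num Star) (Imp (infinite_at Std Star (num Star 0))
       (Imp (Omega_invariant 1 \<psi>)
         (Exists (Sets Std) (Forall (Num Std)
           (Iff (shift (Sets Std) (at_omega \<psi>)) (Mem Std (num Std 0) (sv Std 0)))))))
      | \<psi>. delta0 Std \<psi>}"

definition sNSA_axioms :: "form set" where
  "sNSA_axioms = ISigma1 Std \<union> ISigma1 Star \<union> embedding Std Star \<union> {end_extension Std Star}
     \<union> Omega_CA \<union> Delta0_TRANS Std Star \<union> Delta0_underspill Std Star"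

text \<open>The intermediate level: $\mathbb{N}\subsetneq\mathbb{N}_1\subsetneq{}^{*}\mathbb{N}$, where the composition of
  the two inclusions is the embedding of $\mathbb{N}$ into ${}^{*}\mathbb{N}$.\<close>

definition level_axioms :: "form set" where
  "level_axioms = embedding Std Fin1 \<union> embedding Fin1 Star
     \<union> {Eq Star (Emb Fin1 Star (Emb Std Fin1 (num Std 0))) (Emb Std Star (num Std 0)),
        Iff (Mem Star (num Star 0) (SEmb Fin1 Star (SEmb Std Fin1 (sv Std 0))))
            (Mem Star (num Star 0) (SEmb Std Star (sv Std 0))),
        Exists (Num Fin1) (infinite_at Std Fin1 (num Fin1 0)),
        Exists (Num Star) (infinite_at Fin1 Star (num Star 0))}
     \<union> Delta0_TRANS Std Fin1 \<union> Delta0_TRANS Fin1 Star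
     \<union> Delta0_underspill Std Fin1 \<union> Delta0_underspill Fin1 Star"

definition NSA_axioms :: "form set" where
  "NSA_axioms = sNSA_axioms \<union> level_axioms"

text \<open>\<open>\<Gamma> \<turnstile> A\<close>: classical many-sorted natural deduction from the axioms of NSA and the hypotheses
  \<open>\<Gamma>\<close>, together with the transfer rule, which applies to theorems of NSA (not to consequences of
  hypotheses).  Only terms of the right sort are substituted for variables.\<close>

inductive NSA_proves :: "form set \<Rightarrow> form \<Rightarrow> bool" (infix "\<turnstile>" 50) where
  axiom: "A \<in> NSA_axioms \<Longrightarrow> \<Gamma> \<turnstile> A"
| transfer_rule: "delta0 Std \<phi> \<Longrightarrow> {} \<turnstile> Forall (Num Std) \<phi> \<Longrightarrow>
    \<Gamma> \<turnstile> Forall (Num Star) (star Std Star [num Star 0] \<phi>)"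
| hyp: "A \<in> \<Gamma> \<Longrightarrow> \<Gamma> \<turnstile> A"
| classical: "insert (Neg A) \<Gamma> \<turnstile> Fls \<Longrightarrow> \<Gamma> \<turnstile> A"
| ImpI: "insert A \<Gamma> \<turnstile> B \<Longrightarrow> \<Gamma> \<turnstile> Imp A B"
| ImpE: "\<Gamma> \<turnstile> Imp A B \<Longrightarrow> \<Gamma> \<turnstile> A \<Longrightarrow> \<Gamma> \<turnstile> B"
| AndI: "\<Gamma> \<turnstile> A \<Longrightarrow> \<Gamma> \<turnstile> B \<Longrightarrow> \<Gamma> \<turnstile> And A B"
| AndE1: "\<Gamma> \<turnstile> And A B \<Longrightarrow> \<Gamma> \<turnstile> A"
| AndE2: "\<Gamma> \<turnstile> And A B \<Longrightarrow> \<Gamma> \<turnstile> B"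
| OrI1: "\<Gamma> \<turnstile> A \<Longrightarrow> \<Gamma> \<turnstile> Or A B"
| OrI2: "\<Gamma> \<turnstile> B \<Longrightarrow> \<Gamma> \<turnstile> Or A B"
| OrE: "\<Gamma> \<turnstile> Or A B \<Longrightarrow> insert A \<Gamma> \<turnstile> C \<Longrightarrow> insert B \<Gamma> \<turnstile> C \<Longrightarrow> \<Gamma> \<turnstile> C"
| ForallI: "shift s ` \<Gamma> \<turnstile> A \<Longrightarrow> \<Gamma> \<turnstile> Forall s A"
| ForallE: "\<Gamma> \<turnstile> Forall s A \<Longrightarrow> has_srt t s \<Longrightarrow> \<Gamma> \<turnstile> inst s t A"
| ExistsI: "\<Gamma> \<turnstile> inst s t A \<Longrightarrow> has_srt t s \<Longrightarrow> \<Gamma> \<turnstile> Exists s A"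
| ExistsE: "\<Gamma> \<turnstile> Exists s A \<Longrightarrow> insert A (shift s ` \<Gamma>) \<turnstile> shift s B \<Longrightarrow> \<Gamma> \<turnstile> B"
| BAll_iff: "\<Gamma> \<turnstile> Iff (BAll l t A)
    (Forall (Num l) (Imp (Less l (num l 0) (shift_tm (Num l) t)) A))"
| BEx_iff: "\<Gamma> \<turnstile> Iff (BEx l t A)
    (Exists (Num l) (And (Less l (num l 0) (shift_tm (Num l) t)) A))"
| Eq_refl: "has_srt t (Num l) \<Longrightarrow> \<Gamma> \<turnstile> Eq l t t"
| Eq_subst: "\<Gamma> \<turnstile> Eq l t u \<Longrightarrow> has_srt t (Num l) \<Longrightarrow> has_srt u (Num l) \<Longrightarrow>
    \<Gamma> \<turnstile> inst (Num l) t A \<Longrightarrow> \<Gamma> \<turnstile> inst (Num l) u A"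

section \<open>Hyperconnectives\<close>

definition triv :: form where
  "triv = Eq Std (Zero Std) (Zero Std)"

definition absurd :: form where
  "absurd = Eq Std (Zero Std) (One Std)"

text \<open>\<open>n_finite n m\<close>: $m$ is $n$-finite, i.e. belongs to every level to which $n$ belongs.\<close>

definition n_finite :: "trm \<Rightarrow> trm \<Rightarrow> form" where
  "n_finite n m = And (Imp (finite_at Std Star n) (finite_at Std Star m))
                      (Imp (finite_at Fin1 Star n) (finite_at Fin1 Star m))"

text \<open>The formulas \<open>A\<close> suitable for transfer, each with the formula \<open>B\<close> such that
  $A\in\mathbb{T}$ is \<open>A \<rightarrow> B\<close>.\<close>

inductive transfers_to :: "form \<Rightarrow> form \<Rightarrow> bool" where
  "delta0 Std \<phi> \<Longrightarrow> transfers_to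
     (Forall (Num Std) \<phi>)
     (Forall (Num Star) (star Std Star [num Star 0] \<phi>))"
| "delta0 Std \<phi> \<Longrightarrow> transfers_to
     (Exists (Num Star) (star Std Star [num Star 0] \<phi>))
     (Exists (Num Fin1) (star Std Star [Emb Fin1 Star (num Fin1 0)] \<phi>))"
| "delta0 Std \<phi> \<Longrightarrow> transfers_to
     (Forall (Num Std) (Exists (Num Std) \<phi>))
     (Forall (Num Star) (Exists (Num Star)
       (And (n_finite (num Star 1) (num Star 0)) (star Std Star [num Star 0, num Star 1] \<phi>))))"
| "delta0 Std \<phi> \<Longrightarrow> transfers_to
     (Exists (Num Star) (Forall (Num Star) (star Std Star [num Star 0, num Star 1] \<phi>)))
     (Exists (Num Fin1) (Forall (Num Star)
       (star Std Star [num Star 0, Emb Fin1 Star (num Fin1 0)] \<phi>)))"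

text \<open>
  Formulas built with the hyperconnectives do not literally have one of these shapes, and
  $A\in\mathbb{T}$ refers to the shape they have after evident simplification: ${\sim}P$ for
  $P=(\exists n\in\mathbb{N})\varphi(n)$ is literally $[P\wedge 0=0]\rightarrow[0=1\wedge 0=0]$ and counts as
  $(\forall n\in\mathbb{N})\neg\varphi(n)$; likewise ${\sim}(\forall n\in\mathbb{N})\varphi(n)$ counts as
  $(\exists n\in{}^{*}\mathbb{N})\neg\varphi(n)$.  The function \<open>shape\<close> replaces $[A\wedge A\in\mathbb{T}]$ by \<open>A\<close> if
  $A\in\mathbb{T}$ is trivial and by \<open>B\<close> if $A\in\mathbb{T}$ is \<open>A \<rightarrow> B\<close> (as \<open>B\<close> implies \<open>A\<close> in all four
  cases), and moves the negation of a hypernegation past the unbounded quantifiers.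
\<close>

fun dual :: "form \<Rightarrow> form" where
  "dual (Forall s A) = Exists s (dual A)"
| "dual (Exists s A) = Forall s (dual A)"
| "dual A = Neg A"

fun shape :: "form \<Rightarrow> form" where
  "shape (And A (Imp A' B)) = (if A' = A then shape B else And A (Imp A' B))"
| "shape (And A B) = (if B = triv then shape A else And A B)"
| "shape (Imp A B) = (if shape B = absurd then dual (shape A) else Imp A B)"
| "shape A = A"

definition in_T :: "form \<Rightarrow> form" where
  "in_T A = (if \<exists>B. transfers_to (shape A) B
             then Imp A (THE B. transfers_to (shape A) B)
             else triv)"

definition hyper_imp :: "form \<Rightarrow> form \<Rightarrow> form" where
  "hyper_imp A B = Imp (And A (in_T A)) (And B (in_T B))"

definition hyper_neg :: "form \<Rightarrow> form" where
  "hyper_neg A = hyper_imp A absurd"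

text \<open>\<open>decides k \<psi> A B\<close>: for some $\omega\in\Omega$, the formula $\psi(\vec x,\omega)$ is
  $\Omega$-invariant and decides between $A(\vec x)$ and $B(\vec x)$ for all $\vec x\in\mathbb{N}^k$.\<close>

definition decides :: "nat \<Rightarrow> form \<Rightarrow> form \<Rightarrow> form \<Rightarrow> form" where
  "decides k \<psi> A B = Exists (Num Star) (And (infinite_at Std Star (num Star 0))
     (And (Omega_invariant k \<psi>)
       (Foralls k (And
         (Imp (at_omega \<psi>) (shift (Num Star) (And A (in_T A))))
         (Imp (Neg (at_omega \<psi>)) (shift (Num Star) (And B (in_T B))))))))"

text \<open>\<open>std_args k A\<close>: all standard number variables of \<open>A\<close> are among the first \<open>k\<close>.\<close>

definition std_args :: "nat \<Rightarrow> form \<Rightarrow> bool" where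
  "std_args k A \<longleftrightarrow> (\<forall>i. (Num Std, i) \<in> fv A \<longrightarrow> i < k)"

text \<open>\<open>A \<oplus> B\<close> holds in the theory with hypotheses \<open>\<Gamma>\<close>.  The quantifier over \<open>\<psi>\<close> ranges over
  formulas and is therefore a quantifier of the metatheory.\<close>

definition oplus :: "form set \<Rightarrow> nat \<Rightarrow> form \<Rightarrow> form \<Rightarrow> bool" where
  "oplus \<Gamma> k A B \<longleftrightarrow> (\<exists>\<psi>. delta0 Std \<psi> \<and> std_args (Suc k) \<psi> \<and> \<Gamma> \<turnstile> decides k \<psi> A B)"

definition LPO :: "form set \<Rightarrow> bool" where
  "LPO \<Gamma> \<longleftrightarrow> (\<forall>k P. sigma1 Std P \<and> std_args k P \<longrightarrow> oplus \<Gamma> k P (hyper_neg P))"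

definition Pi1_TRANS :: "form set \<Rightarrow> bool" where
  "Pi1_TRANS \<Gamma> \<longleftrightarrow> (\<forall>\<phi>. delta0 Std \<phi> \<longrightarrow>
     \<Gamma> \<turnstile> Imp (Forall (Num Std) \<phi>) (Forall (Num Star) (star Std Star [num Star 0] \<phi>)))"

end

theory Submission
  imports Defs
begin

text \<open>
  For $P=(\exists n\in\mathbb{N})\varphi(n,\vec x)$ the deciding formula is
  $\psi(\vec x,\omega)=(\exists n<\omega)\varphi(n,\vec x)$.  If $P$ holds, its witness lies below every
  infinite $\omega$, since ${}^{*}\mathbb{N}$ is an end extension of $\mathbb{N}$; if $P$ fails, then
  $\Pi_1$-TRANS refutes $\varphi$ on all of ${}^{*}\mathbb{N}$.  Hence $\psi(\vec x,\omega)$ is equivalent to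
  $P$ for every infinite $\omega$, which gives both its $\Omega$-invariance and the decision.
  Conversely, decide $(\exists n\in\mathbb{N})\neg\varphi(n)$.  If $(\forall n\in\mathbb{N})\varphi(n)$ holds, then
  $\psi$ is false, and the second disjunct comes with membership in $\mathbb{T}$, which is
  precisely the transfer of $(\forall n\in\mathbb{N})\varphi(n)$.
\<close>

section \<open>Substitution\<close>

lemma subst_tm_cong:
  "(\<And>s i. (s, i) \<in> fv_tm t \<Longrightarrow> \<sigma> s i = \<tau> s i) \<Longrightarrow> subst_tm \<sigma> t = subst_tm \<tau> t"
  by (induction t) auto

text \<open>Index \<open>0\<close> of sort \<open>s\<close> is fixed by both environments, and every
  other index in \<open>V\<close> comes from one in \<open>unbind s V\<close>, where they
  agree.\<close>

lemma under_cong: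
  assumes "\<And>s' i. (s', i) \<in> unbind s V \<Longrightarrow> \<sigma> s' i = \<tau> s' i" and "(s', i) \<in> V"
  shows "under s \<sigma> s' i = under s \<tau> s' i"
  using assms by (auto simp: under_def unbind_def split: nat.split)

lemma subst_cong:
  "(\<And>s i. (s, i) \<in> fv A \<Longrightarrow> \<sigma> s i = \<tau> s i) \<Longrightarrow> subst \<sigma> A = subst \<tau> A"
proof (induction A arbitrary: \<sigma> \<tau>)
  case (BAll l t A)
  have "subst (under (Num l) \<sigma>) A = subst (under (Num l) \<tau>) A"
    by (rule BAll.IH) (rule under_cong, use BAll.prems in auto)
  then show ?case using BAll.prems by (auto intro: subst_tm_cong)
next
  case (BEx l t A)
  have "subst (under (Num l) \<sigma>) A = subst (under (Num l) \<tau>) A"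
    by (rule BEx.IH) (rule under_cong, use BEx.prems in auto)
  then show ?case using BEx.prems by (auto intro: subst_tm_cong)
next
  case (Forall s A)
  have "subst (under s \<sigma>) A = subst (under s \<tau>) A"
    by (rule Forall.IH) (rule under_cong, use Forall.prems in auto)
  then show ?case by simp
next
  case (Exists s A)
  have "subst (under s \<sigma>) A = subst (under s \<tau>) A"
    by (rule Exists.IH) (rule under_cong, use Exists.prems in auto)
  then show ?case by simp
next
  case (Imp A B)
  show ?case using Imp.IH[of \<sigma> \<tau>] Imp.prems by simp
next
  case (And A B)
  show ?case using And.IH[of \<sigma> \<tau>] And.prems by simp
next
  case (Or A B)
  show ?case using Or.IH[of \<sigma> \<tau>] Or.prems by simp
qed (auto intro: subst_tm_cong)

lemma subst_tm_Var: "subst_tm Var t = t"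
  by (induction t) auto

lemma under_Var: "under s Var = Var"
  by (auto simp: under_def shift_tm_def shift_env_def fun_eq_iff split: nat.split)

lemma subst_Var: "subst Var A = A"
  by (induction A) (auto simp: subst_tm_Var under_Var)

lemma subst_id: "(\<And>s i. (s, i) \<in> fv A \<Longrightarrow> \<sigma> s i = Var s i) \<Longrightarrow> subst \<sigma> A = A"
  using subst_cong[of A \<sigma> Var] by (simp add: subst_Var)

lemma subst_tm_subst_tm:
  "subst_tm \<sigma> (subst_tm \<tau> t) = subst_tm (\<lambda>s i. subst_tm \<sigma> (\<tau> s i)) t"
  by (induction t) auto

lemma subst_tm_under_shift_tm:
  "subst_tm (under s \<sigma>) (shift_tm s t) = shift_tm s (subst_tm \<sigma> t)"
  by (auto simp: shift_tm_def subst_tm_subst_tm shift_env_def under_def intro!: subst_tm_cong)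

text \<open>This is the binder case of \<open>subst_subst\<close>: both environments keep index
  \<open>0\<close>, and on the other indices substitution commutes with weakening.\<close>

lemma under_comp:
  "(\<lambda>s' i. subst_tm (under s \<sigma>) (under s \<tau> s' i)) = under s (\<lambda>s' i. subst_tm \<sigma> (\<tau> s' i))"
proof (intro ext)
  fix s' i
  show "subst_tm (under s \<sigma>) (under s \<tau> s' i) = under s (\<lambda>s' i. subst_tm \<sigma> (\<tau> s' i)) s' i"
    by (cases i; cases "s' = s")
      (auto simp: under_def[of s \<tau>] under_def[of s "\<lambda>s' i. subst_tm \<sigma> (\<tau> s' i)"]
        subst_tm_under_shift_tm, simp_all add: under_def)
qed

lemma subst_subst: "subst \<sigma> (subst \<tau> A) = subst (\<lambda>s i. subst_tm \<sigma> (\<tau> s i)) A"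
  by (induction A arbitrary: \<sigma> \<tau>) (simp_all add: subst_tm_subst_tm under_comp)

lemma subst_tm_inst_shift_tm:
  "subst_tm (\<lambda>s' i. if s' = s then (case i of 0 \<Rightarrow> t | Suc j \<Rightarrow> Var s j) else Var s' i)
     (shift_tm s u) = u"
  (is "subst_tm ?\<sigma> _ = _")
proof -
  have "subst_tm ?\<sigma> (shift_tm s u) = subst_tm Var u"
    unfolding shift_tm_def subst_tm_subst_tm by (rule subst_tm_cong) (simp add: shift_env_def)
  then show ?thesis by (simp add: subst_tm_Var)
qed

text \<open>Once a rule has shifted its context, the fresh eigenvariable has index \<open>0\<close>.
  Opening a shifted quantifier at that variable gives back the original body.\<close>

lemma inst_under_shift_env: "inst s (Var s 0) (subst (under s (shift_env s)) A) = A"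
proof -
  have "inst s (Var s 0) (subst (under s (shift_env s)) A) = subst Var A"
    unfolding inst_def subst_subst
    by (rule subst_cong) (auto simp: shift_env_def under_def shift_tm_def split: nat.split)
  then show ?thesis by (simp add: subst_Var)
qed

lemma shift_sentence: "sentence A \<Longrightarrow> shift s A = A"
  unfolding shift_def by (rule subst_id) (simp add: sentence_def)

text \<open>Closedness of the hypotheses enters here: \<open>ForallI\<close> and
  \<open>ExistsE\<close> leave a context of sentences as it is.\<close>

lemma image_shift_sentences: "\<forall>A\<in>\<Gamma>. sentence A \<Longrightarrow> shift s ` \<Gamma> = \<Gamma>"
  by (auto simp: shift_sentence image_iff)

section \<open>Bounded formulas\<close>

lemma fv_arith_tm: "arith_tm l t \<Longrightarrow> (s, i) \<in> fv_tm t \<Longrightarrow> s = Num l"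
  by (induction t) auto

text \<open>A bounded formula lives at a single level, so substitutions that act on other levels do
  not touch it.\<close>

lemma fv_delta0: "delta0 l A \<Longrightarrow> (s, i) \<in> fv A \<Longrightarrow> s = Num l \<or> s = Sets l"
proof (induction A arbitrary: i)
  case (BAll l' t A)
  then show ?case by (auto simp: unbind_def dest: fv_arith_tm)
next
  case (BEx l' t A)
  then show ?case by (auto simp: unbind_def dest: fv_arith_tm)
qed (auto dest: fv_arith_tm)

lemma arith_tm_map: "arith_tm l t \<Longrightarrow> arith_tm l' (map_tm (\<lambda>_. l') t)"
  by (induction t) auto

lemma delta0_map: "delta0 l A \<Longrightarrow> delta0 l' (map_fm (\<lambda>_. l') A)"
  by (induction A) (auto simp: arith_tm_map)

lemma fv_map_arith_tm:
  "arith_tm l t \<Longrightarrow> (s, i) \<in> fv_tm (map_tm (\<lambda>_. l') t) \<Longrightarrow> s = Num l' \<and> (Num l, i) \<in> fv_tm t"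
  by (induction t) auto

lemma fv_map_delta0:
  "delta0 l A \<Longrightarrow> (Num l', i) \<in> fv (map_fm (\<lambda>_. l') A) \<Longrightarrow> (Num l, i) \<in> fv A"
  by (induction A arbitrary: i) (auto simp: unbind_def dest: fv_map_arith_tm)

lemma finite_fv_tm: "finite (fv_tm t)"
  by (induction t) auto

lemma finite_unbind: "finite V \<Longrightarrow> finite (unbind s V)"
proof -
  assume "finite V"
  moreover have "unbind s V = (\<lambda>(s', i). (s', if s' = s then Suc i else i)) -` V"
    by (auto simp: unbind_def)
  moreover have "inj (\<lambda>(s', i). (s', if s' = s then Suc i else i))"
    by (auto simp: inj_on_def split: if_splits)
  ultimately show ?thesis by (simp add: finite_vimageI)
qed

lemma finite_fv: "finite (fv A)"
  by (induction A) (auto simp: finite_fv_tm finite_unbind)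

lemma ex_std_args: "\<exists>k. std_args k A"
proof -
  have "finite (snd ` fv A)" by (simp add: finite_fv)
  then obtain k where "\<forall>i\<in>snd ` fv A. i < k" by (meson finite_nat_set_iff_bounded)
  then show ?thesis unfolding std_args_def by force
qed

text \<open>\<open>BAll\<close> and \<open>BEx\<close> are constructors of their own, so even a
  formula that begins with a bounded quantifier reaches the last clause of
  \<open>dual\<close>.\<close>

lemma dual_delta0: "delta0 l A \<Longrightarrow> dual A = Neg A"
  by (cases A) auto

section \<open>Renamings and the change of level\<close>

definition renaming :: "env \<Rightarrow> bool" where
  "renaming \<rho> \<longleftrightarrow> (\<forall>s i. \<exists>j. \<rho> s i = Var s j)"

lemma renaming_under: "renaming \<rho> \<Longrightarrow> renaming (under s \<rho>)"
  unfolding renaming_def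
proof (intro allI)
  fix s' i
  assume r: "\<forall>s i. \<exists>j. \<rho> s i = Var s j"
  show "\<exists>j. under s \<rho> s' i = Var s' j"
    using r[rule_format, of s' i] r[rule_format, of s' "i - 1"]
    by (cases i) (auto simp: under_def shift_tm_def shift_env_def)
qed

lemma arith_tm_renaming: "renaming \<rho> \<Longrightarrow> arith_tm l t \<Longrightarrow> arith_tm l (subst_tm \<rho> t)"
proof (induction t)
  case (Var s i)
  then obtain j where "\<rho> s i = Var s j" unfolding renaming_def by blast
  then show ?case using Var by auto
qed auto

text \<open>An arbitrary substitution may leave the bounded formulas: embedded terms are not
  arithmetical, and the right side of \<open>Mem\<close> has to be a variable. Renamings within each
  sort avoid both obstacles.\<close>

lemma delta0_renaming: "renaming \<rho> \<Longrightarrow> delta0 l A \<Longrightarrow> delta0 l (subst \<rho> A)"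
proof (induction A arbitrary: \<rho>)
  case (Mem l' t u)
  then obtain i where u: "u = sv l i" by auto
  obtain j where "\<rho> (Sets l) i = sv l j" using Mem unfolding renaming_def by blast
  then show ?case using Mem u by (auto simp: arith_tm_renaming)
qed (auto simp: arith_tm_renaming renaming_under)

text \<open>\<open>\<tau>\<close> is the composition of the renaming \<open>\<rho>\<close>, acting at level \<open>Std\<close>, with \<open>\<sigma>\<close>, acting on the images of
  these variables at level \<open>Star\<close>.\<close>

definition follows :: "env \<Rightarrow> env \<Rightarrow> env \<Rightarrow> bool" where
  "follows \<rho> \<sigma> \<tau> \<longleftrightarrow>
    (\<forall>i. \<exists>j. \<rho> (Num Std) i = num Std j \<and> \<tau> (Num Star) i = \<sigma> (Num Star) j) \<and>
    (\<forall>i. \<exists>j. \<rho> (Sets Std) i = sv Std j \<and> \<tau> (Sets Star) i = \<sigma> (Sets Star) j)"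

lemma follows_under:
  assumes "follows \<rho> \<sigma> \<tau>"
  shows "follows (under (Num Std) \<rho>) (under (Num Star) \<sigma>) (under (Num Star) \<tau>)"
  unfolding follows_def
proof (intro conjI allI)
  fix i
  show "\<exists>j. under (Num Std) \<rho> (Num Std) i = num Std j
    \<and> under (Num Star) \<tau> (Num Star) i = under (Num Star) \<sigma> (Num Star) j"
  proof (cases i)
    case 0
    then show ?thesis by (intro exI[of _ 0]) (simp add: under_def)
  next
    case (Suc m)
    obtain j where "\<rho> (Num Std) m = num Std j \<and> \<tau> (Num Star) m = \<sigma> (Num Star) j"
      using assms unfolding follows_def by blast
    then show ?thesis using Suc
      by (intro exI[of _ "Suc j"]) (simp add: under_def shift_tm_def shift_env_def)
  qed
  obtain j where "\<rho> (Sets Std) i = sv Std j \<and> \<tau> (Sets Star) i = \<sigma> (Sets Star) j"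
    using assms unfolding follows_def by blast
  then show "\<exists>j. under (Num Std) \<rho> (Sets Std) i = sv Std j
    \<and> under (Num Star) \<tau> (Sets Star) i = under (Num Star) \<sigma> (Sets Star) j"
    by (intro exI[of _ j]) (simp add: under_def shift_tm_def shift_env_def)
qed

lemma subst_tm_map_follows:
  assumes "follows \<rho> \<sigma> \<tau>" and "arith_tm Std t"
  shows "subst_tm \<sigma> (map_tm (\<lambda>_. Star) (subst_tm \<rho> t)) = subst_tm \<tau> (map_tm (\<lambda>_. Star) t)"
  using assms(2)
proof (induction t)
  case (Var s i)
  obtain j where "\<rho> (Num Std) i = num Std j \<and> \<tau> (Num Star) i = \<sigma> (Num Star) j"
    using assms(1) unfolding follows_def by blast
  then show ?case using Var by auto
qed auto

text \<open>A change of level separates the two substitutions, so \<open>subst_subst\<close> does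
  not compose them. The relation \<open>follows\<close> does, and it passes through the
  binders.\<close>

lemma subst_map_follows:
  "follows \<rho> \<sigma> \<tau> \<Longrightarrow> delta0 Std A \<Longrightarrow>
   subst \<sigma> (map_fm (\<lambda>_. Star) (subst \<rho> A)) = subst \<tau> (map_fm (\<lambda>_. Star) A)"
proof (induction A arbitrary: \<rho> \<sigma> \<tau>)
  case (Mem l t u)
  then obtain i where u: "u = sv Std i" by auto
  obtain j where "\<rho> (Sets Std) i = sv Std j \<and> \<tau> (Sets Star) i = \<sigma> (Sets Star) j"
    using Mem(1) unfolding follows_def by blast
  then show ?case using Mem u by (auto simp: subst_tm_map_follows)
qed (auto simp: subst_tm_map_follows follows_under)

section \<open>Free variables of substitution instances\<close>

lemma fv_subst_tm: "fv_tm (subst_tm \<sigma> t) = (\<Union>(s, i)\<in>fv_tm t. fv_tm (\<sigma> s i))"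
  by (induction t) auto

lemma unbind_UN: "unbind s (\<Union>x\<in>V. f x) = (\<Union>x\<in>V. unbind s (f x))"
  by (auto simp: unbind_def)

lemma unbind_fv_shift_tm: "unbind s (fv_tm (shift_tm s t)) = fv_tm t"
  unfolding shift_tm_def fv_subst_tm by (force simp: unbind_def shift_env_def split: if_splits)

text \<open>Index \<open>0\<close> of sort \<open>s\<close> contributes only the bound variable,
  which \<open>unbind\<close> discards; for all other variables \<open>unbind\<close> undoes the
  shift.\<close>

lemma unbind_fv_under:
  "unbind s (\<Union>(s', i)\<in>V. fv_tm (under s \<sigma> s' i)) \<subseteq> (\<Union>(s', i)\<in>unbind s V. fv_tm (\<sigma> s' i))"
proof -
  have "unbind s (fv_tm (under s \<sigma> s' i)) \<subseteq> (\<Union>(s', i)\<in>unbind s V. fv_tm (\<sigma> s' i))"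
    if "(s', i) \<in> V" for s' i
  proof (cases "s' = s")
    case True
    show ?thesis
    proof (cases i)
      case 0
      then show ?thesis using True by (auto simp: under_def unbind_def)
    next
      case (Suc j)
      then have "(s, j) \<in> unbind s V" using that True by (simp add: unbind_def)
      then show ?thesis using True Suc by (force simp: under_def unbind_fv_shift_tm)
    qed
  next
    case False
    then have "(s', i) \<in> unbind s V" using that by (simp add: unbind_def)
    then show ?thesis using False by (force simp: under_def unbind_fv_shift_tm)
  qed
  then have "unbind s (case x of (s', i) \<Rightarrow> fv_tm (under s \<sigma> s' i))
      \<subseteq> (\<Union>(s', i)\<in>unbind s V. fv_tm (\<sigma> s' i))" if "x \<in> V" for x
    using that by (cases x) simp
  then show ?thesis unfolding unbind_UN by (rule UN_least)
qed

lemma unbind_mono: "V \<subseteq> W \<Longrightarrow> unbind s V \<subseteq> unbind s W"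
  by (auto simp: unbind_def)

lemma fv_subst: "fv (subst \<sigma> A) \<subseteq> (\<Union>(s, i)\<in>fv A. fv_tm (\<sigma> s i))"
proof (induction A arbitrary: \<sigma>)
  case (BAll l t A)
  have "unbind (Num l) (fv (subst (under (Num l) \<sigma>) A)) \<subseteq> (\<Union>(s, i)\<in>unbind (Num l) (fv A). fv_tm (\<sigma> s i))"
    by (rule subset_trans[OF unbind_mono[OF BAll.IH] unbind_fv_under])
  then show ?case by (simp add: fv_subst_tm UN_Un) blast
next
  case (BEx l t A)
  have "unbind (Num l) (fv (subst (under (Num l) \<sigma>) A)) \<subseteq> (\<Union>(s, i)\<in>unbind (Num l) (fv A). fv_tm (\<sigma> s i))"
    by (rule subset_trans[OF unbind_mono[OF BEx.IH] unbind_fv_under])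
  then show ?case by (simp add: fv_subst_tm UN_Un) blast
next
  case (Forall s A)
  show ?case using subset_trans[OF unbind_mono[OF Forall.IH] unbind_fv_under] by simp
next
  case (Exists s A)
  show ?case using subset_trans[OF unbind_mono[OF Exists.IH] unbind_fv_under] by simp
next
  case (Imp A B)
  show ?case using Imp.IH[of \<sigma>] by (simp add: UN_Un) blast
next
  case (And A B)
  show ?case using And.IH[of \<sigma>] by (simp add: UN_Un) blast
next
  case (Or A B)
  show ?case using Or.IH[of \<sigma>] by (simp add: UN_Un) blast
qed (simp_all add: fv_subst_tm UN_Un)

section \<open>Derived rules\<close>

lemma weakening: "\<Gamma> \<turnstile> A \<Longrightarrow> \<Gamma> \<subseteq> \<Delta> \<Longrightarrow> \<Delta> \<turnstile> A"
proof (induction arbitrary: \<Delta> rule: NSA_proves.induct)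
  case (OrE \<Gamma> A B C)
  show ?case by (rule NSA_proves.OrE) (rule OrE.IH, use OrE.prems in blast)+
next
  case (ForallI s \<Gamma> A)
  show ?case by (rule NSA_proves.ForallI) (rule ForallI.IH, use ForallI.prems in blast)
next
  case (ExistsE \<Gamma> s A B)
  show ?case by (rule NSA_proves.ExistsE) (rule ExistsE.IH, use ExistsE.prems in blast)+
next
  case (classical A \<Gamma>)
  show ?case by (rule NSA_proves.classical) (rule classical.IH, use classical.prems in blast)
next
  case (ImpI A \<Gamma> B)
  show ?case by (rule NSA_proves.ImpI) (rule ImpI.IH, use ImpI.prems in blast)
next
  case (ImpE \<Gamma> A B)
  show ?case by (rule NSA_proves.ImpE) (rule ImpE.IH, rule ImpE.prems)+
next
  case (AndE1 \<Gamma> A B)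
  show ?case by (rule NSA_proves.AndE1) (rule AndE1.IH, rule AndE1.prems)
next
  case (AndE2 \<Gamma> A B)
  show ?case by (rule NSA_proves.AndE2) (rule AndE2.IH, rule AndE2.prems)
next
  case (ForallE \<Gamma> s A t)
  show ?case by (rule NSA_proves.ForallE) (rule ForallE.IH, rule ForallE.prems, rule ForallE.hyps)
next
  case (ExistsI \<Gamma> s t A)
  show ?case by (rule NSA_proves.ExistsI) (rule ExistsI.IH, rule ExistsI.prems, rule ExistsI.hyps)
next
  case (Eq_subst \<Gamma> l t u A)
  show ?case
    by (rule NSA_proves.Eq_subst) (rule Eq_subst.IH Eq_subst.hyps Eq_subst.prems)+
next
  \<comment> \<open>The premise of the transfer rule is derived from no hypotheses, so it is reused
    unchanged while the context grows.\<close>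
  case (transfer_rule \<phi> \<Gamma>)
  show ?case by (rule NSA_proves.transfer_rule) (rule transfer_rule.hyps)+
next
  case (AndI \<Gamma> A B)
  show ?case by (rule NSA_proves.AndI) (rule AndI.IH, rule AndI.prems)+
next
  case (OrI1 \<Gamma> A B)
  show ?case by (rule NSA_proves.OrI1) (rule OrI1.IH, rule OrI1.prems)
next
  case (OrI2 \<Gamma> B A)
  show ?case by (rule NSA_proves.OrI2) (rule OrI2.IH, rule OrI2.prems)
next
  case (hyp A \<Gamma>)
  then show ?case by (intro NSA_proves.hyp) blast
qed (rule NSA_proves.axiom NSA_proves.BAll_iff NSA_proves.BEx_iff NSA_proves.Eq_refl, assumption?)+

lemma theorem_in_context: "{} \<turnstile> A \<Longrightarrow> \<Gamma> \<turnstile> A"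
  by (rule weakening) auto

lemma FlsE: "\<Gamma> \<turnstile> Fls \<Longrightarrow> \<Gamma> \<turnstile> A"
  by (rule classical) (rule weakening, auto)

text \<open>Axioms carry free variables in place of universal quantifiers. Over the empty context,
  which no shift affects, they can be generalised and then instantiated.\<close>

lemma theorem_inst:
  assumes "{} \<turnstile> A" and "has_srt t s"
  shows "\<Gamma> \<turnstile> inst s t A"
  by (rule theorem_in_context, rule ForallE[OF ForallI]) (use assms in auto)

lemma sentences_inst:
  assumes "\<forall>A\<in>\<Gamma>. sentence A" and "\<Gamma> \<turnstile> A" and "has_srt t s"
  shows "\<Gamma> \<turnstile> inst s t A"
  by (rule ForallE[OF ForallI]) (use assms in \<open>auto simp: image_shift_sentences\<close>)

text \<open>The eigenvariable is itself a term, so a universal hypothesis that was shifted past it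
  can be applied to it.\<close>

lemma Forall_body: "shift s (Forall s A) \<in> \<Gamma> \<Longrightarrow> \<Gamma> \<turnstile> A"
  using ForallE[of \<Gamma> s "subst (under s (shift_env s)) A" "Var s 0"]
  by (auto simp: shift_def inst_under_shift_env intro: hyp)

lemma Forall_mono:
  assumes "{} \<turnstile> Imp A B" and "\<Gamma> \<turnstile> Forall s A"
  shows "\<Gamma> \<turnstile> Forall s B"
proof -
  have "{Forall s A} \<turnstile> Forall s B"
    by (rule ForallI, rule ImpE[OF theorem_in_context[OF assms(1)]], rule Forall_body) simp
  then show ?thesis
    using ImpE[OF theorem_in_context[OF ImpI] assms(2)] by simp
qed

lemma Exists_of_body: "\<Gamma> \<turnstile> A \<Longrightarrow> \<Gamma> \<turnstile> shift s (Exists s A)"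
  using ExistsI[of \<Gamma> s "Var s 0" "subst (under s (shift_env s)) A"]
  by (simp add: shift_def inst_under_shift_env)

lemma not_Exists_imp_Forall_not: "{} \<turnstile> Imp (Neg (Exists s A)) (Forall s (Neg A))"
proof -
  have "{A, shift s (Neg (Exists s A))} \<turnstile> Fls"
  proof (rule ImpE)
    show "{A, shift s (Neg (Exists s A))} \<turnstile> Neg (shift s (Exists s A))"
      by (rule hyp) (simp add: shift_def)
    show "{A, shift s (Neg (Exists s A))} \<turnstile> shift s (Exists s A)"
      by (rule Exists_of_body, rule hyp) simp
  qed
  then show ?thesis by (auto intro!: ImpI ForallI)
qed

lemma Forall_imp_not_Exists_not: "{} \<turnstile> Imp (Forall s A) (Neg (Exists s (Neg A)))"
proof -
  have "insert (Neg A) (shift s ` {Exists s (Neg A), Forall s A}) \<turnstile> Fls" (is "?\<Delta> \<turnstile> _")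
  proof (rule ImpE)
    show "?\<Delta> \<turnstile> Neg A" by (rule hyp) simp
    show "?\<Delta> \<turnstile> A" by (rule Forall_body[of s]) simp
  qed
  then have "{Exists s (Neg A), Forall s A} \<turnstile> Fls"
    using ExistsE[where s = s and A = "Neg A" and B = Fls, OF hyp] by (simp add: shift_def)
  then show ?thesis by (intro ImpI)
qed

lemma double_negation: "{} \<turnstile> Imp (Neg (Neg A)) A"
  by (rule ImpI, rule classical, rule ImpE[of _ "Neg A"]) (auto intro: hyp)

text \<open>Leibniz's rule is applied to the template \<open>x = t\<close>, with the hole
  \<open>x\<close> at index \<open>0\<close> and \<open>t\<close> shifted past it.\<close>

lemma Eq_sym:
  assumes "\<Gamma> \<turnstile> Eq l t u" and "has_srt t (Num l)" and "has_srt u (Num l)"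
  shows "\<Gamma> \<turnstile> Eq l u t"
  using Eq_subst[OF assms, of "Eq l (num l 0) (shift_tm (Num l) t)"] Eq_refl[OF assms(2)]
  by (simp add: inst_def subst_tm_inst_shift_tm)

lemma Eq_trans:
  assumes "\<Gamma> \<turnstile> Eq l t u" and "\<Gamma> \<turnstile> Eq l u v" and "has_srt u (Num l)" and "has_srt v (Num l)"
  shows "\<Gamma> \<turnstile> Eq l t v"
  using Eq_subst[OF assms(2-), of "Eq l (shift_tm (Num l) t) (num l 0)"] assms(1)
  by (simp add: inst_def subst_tm_inst_shift_tm)

section \<open>Blocks of standard universal quantifiers\<close>

lemma ForallsI:
  assumes "shift (Num Std) ` \<Gamma> = \<Gamma>" and "\<Gamma> \<turnstile> A"
  shows "\<Gamma> \<turnstile> Foralls k A"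
proof (induction k)
  case (Suc k)
  have "shift (Num Std) ` \<Gamma> \<turnstile> Foralls k A" using Suc assms(1) by simp
  then show ?case by (auto simp: Foralls_def intro: ForallI)
qed (simp add: Foralls_def assms(2))

lemma Foralls_Suc: "Foralls (Suc k) A = Foralls k (Forall (Num Std) A)"
  by (simp add: Foralls_def funpow_swap1)

text \<open>The innermost quantifier binds index \<open>0\<close> and is opened last: the outer
  \<open>k\<close> quantifiers receive \<open>t 1\<close>, \<open>t 2\<close> and so on, then the
  remaining one receives \<open>t 0\<close>.\<close>

lemma Foralls_inst:
  assumes "\<Gamma> \<turnstile> Foralls k A" and "\<And>i. has_srt (t i) (Num Std)"
  shows "\<Gamma> \<turnstile> subst (\<lambda>s i. if s = Num Std then (if i < k then t i else num Std (i - k)) else Var s i) A"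
  using assms
proof (induction k arbitrary: A t)
  case 0
  have "(\<lambda>s i. if s = Num Std then (if i < 0 then t i else num Std (i - 0)) else Var s i) = Var"
    by (auto simp: fun_eq_iff)
  then show ?case using 0 by (simp add: Foralls_def subst_Var)
next
  case (Suc k)
  let ?\<sigma> = "\<lambda>s i. if s = Num Std then (if i < k then t (Suc i) else num Std (i - k)) else Var s i"
  have "\<Gamma> \<turnstile> subst ?\<sigma> (Forall (Num Std) A)"
    by (rule Suc.IH) (use Suc.prems in \<open>simp_all add: Foralls_Suc\<close>)
  then have "\<Gamma> \<turnstile> inst (Num Std) (t 0) (subst (under (Num Std) ?\<sigma>) A)"
    using ForallE Suc.prems(2) by simp
  moreover have "inst (Num Std) (t 0) (subst (under (Num Std) ?\<sigma>) A) =
    subst (\<lambda>s i. if s = Num Std then (if i < Suc k then t i else num Std (i - Suc k)) else Var s i) A"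
    unfolding inst_def subst_subst
    by (rule subst_cong)
      (auto simp: under_def subst_tm_inst_shift_tm split: nat.split; simp add: shift_tm_def shift_env_def)
  ultimately show ?case by simp
qed

text \<open>Each bound variable is instantiated by the free variable of the same index. The lowering
  of the indices from \<open>k\<close> on has no effect, as none of them occurs.\<close>

lemma Foralls_body:
  assumes "\<Gamma> \<turnstile> Foralls k A" and "std_args k A"
  shows "\<Gamma> \<turnstile> A"
proof -
  have "subst (\<lambda>s i. if s = Num Std then (if i < k then num Std i else num Std (i - k)) else Var s i) A = A"
    using assms(2) by (intro subst_id) (auto simp: std_args_def)
  then show ?thesis using Foralls_inst[OF assms(1), of "num Std"] by simp
qed


text \<open>This serves \<Omega>-invariance: the values at two infinite numbers are compared through
  a formula that contains neither.\<close>

lemma Iff_trans: "\<Gamma> \<turnstile> Iff A C \<Longrightarrow> \<Gamma> \<turnstile> Iff B C \<Longrightarrow> \<Gamma> \<turnstile> Iff A B"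
proof -
  assume AC: "\<Gamma> \<turnstile> Iff A C" and BC: "\<Gamma> \<turnstile> Iff B C"
  have step: "\<Gamma> \<turnstile> Imp X Y" if "\<Gamma> \<turnstile> Imp X C" "\<Gamma> \<turnstile> Imp C Y" for X Y
  proof (rule ImpI)
    have "insert X \<Gamma> \<turnstile> Imp X C" "insert X \<Gamma> \<turnstile> Imp C Y"
      using that by (auto intro: weakening)
    then show "insert X \<Gamma> \<turnstile> Y" using ImpE hyp insertI1 by metis
  qed
  show ?thesis
    by (rule AndI; rule step) (rule AndE1[OF AC] AndE2[OF AC] AndE1[OF BC] AndE2[OF BC])+
qed

lemma Forall_not_imp_not_Exists_And:
  "{} \<turnstile> Imp (Forall s (Neg A)) (Neg (Exists s (And B A)))"
proof -
  have "insert (And B A) (shift s ` {Exists s (And B A), Forall s (Neg A)}) \<turnstile> Fls" (is "?\<Delta> \<turnstile> _")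
  proof (rule ImpE)
    show "?\<Delta> \<turnstile> Neg A" by (rule Forall_body[of s]) simp
    show "?\<Delta> \<turnstile> A" by (rule AndE2[where A = B], rule hyp) simp
  qed
  then have "{Exists s (And B A), Forall s (Neg A)} \<turnstile> Fls"
    using ExistsE[where s = s and A = "And B A" and B = Fls, OF hyp] by (simp add: shift_def)
  then show ?thesis by (intro ImpI)
qed

section \<open>Star images\<close>

text \<open>Before its terms are inserted, a star image has only variables of level
  \<open>Star\<close>, so comparing the inserted terms suffices. The lists may differ in length:
  replacing \<open>num Star 0\<close> by the embedded \<open>num Std 0\<close> can turn
  \<open>[num Star 0]\<close> into \<open>[]\<close>.\<close>

lemma subst_star:
  assumes "delta0 Std \<phi>"
    and "\<And>i. subst_tm \<sigma> (if i < length ts then ts ! i else Emb Std Star (num Std (i - length ts)))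
           = (if i < length us then us ! i else Emb Std Star (num Std (i - length us)))"
    and "\<And>i. \<sigma> (Sets Std) i = sv Std i"
  shows "subst \<sigma> (star Std Star ts \<phi>) = star Std Star us \<phi>"
  unfolding star_def subst_subst
proof (rule subst_cong)
  fix s i
  assume "(s, i) \<in> fv (map_fm (\<lambda>_. Star) \<phi>)"
  then have "s = Num Star \<or> s = Sets Star" by (rule fv_delta0[OF delta0_map[OF assms(1)]])
  then show "subst_tm \<sigma> (case s of Num _ \<Rightarrow> if i < length ts then ts ! i
        else Emb Std Star (num Std (i - length ts)) | Sets _ \<Rightarrow> SEmb Std Star (sv Std i)) =
      (case s of Num _ \<Rightarrow> if i < length us then us ! i
        else Emb Std Star (num Std (i - length us)) | Sets _ \<Rightarrow> SEmb Std Star (sv Std i))"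
    using assms(2)[of i] assms(3)[of i] by auto
qed

lemma star_Neg: "star l l' ts (Neg \<phi>) = Neg (star l l' ts \<phi>)"
  by (simp add: star_def)

lemma fv_star:
  assumes "delta0 Std \<phi>" and "(Num Std, i) \<in> fv (star Std Star [num Star 0] \<phi>)"
  shows "(Num Std, Suc i) \<in> fv \<phi>"
proof -
  obtain s j where sj: "(s, j) \<in> fv (map_fm (\<lambda>_. Star) \<phi>)"
    "(Num Std, i) \<in> fv_tm (case s of
        Num _ \<Rightarrow> if j < length [num Star 0] then [num Star 0] ! j
          else Emb Std Star (num Std (j - length [num Star 0]))
      | Sets _ \<Rightarrow> SEmb Std Star (sv Std j))"
    using assms(2) fv_subst unfolding star_def by blast
  have "s = Num Star \<or> s = Sets Star" by (rule fv_delta0[OF delta0_map[OF assms(1)] sj(1)])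
  then have "s = Num Star" "j = Suc i" using sj(2) by (auto split: if_splits)
  then show ?thesis using fv_map_delta0[OF assms(1), of Star] sj(1) by simp
qed

text \<open>In \<open>bounded_ex \<phi>\<close> the index \<open>0\<close> is the bound $m$ of $(\exists n<m)\varphi(n,\vec x)$, so inside the
  quantifier the indices of $\vec x$ move up by one.\<close>

definition bounded_ex :: "form \<Rightarrow> form" where
  "bounded_ex \<phi> = BEx Std (num Std 0)
     (subst (\<lambda>s i. if s = Num Std \<and> i > 0 then Var s (Suc i) else Var s i) \<phi>)"

lemma delta0_bounded_ex: "delta0 Std \<phi> \<Longrightarrow> delta0 Std (bounded_ex \<phi>)"
  unfolding bounded_ex_def by (auto intro!: delta0_renaming simp: renaming_def)

lemma std_args_bounded_ex:
  assumes "std_args k (Exists (Num Std) \<phi>)"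
  shows "std_args (Suc k) (bounded_ex \<phi>)"
  unfolding std_args_def
proof (intro allI impI)
  let ?\<rho> = "\<lambda>s i. if s = Num Std \<and> i > 0 then Var s (Suc i) else Var s i :: trm"
  fix i
  assume "(Num Std, i) \<in> fv (bounded_ex \<phi>)"
  then consider "i = 0" | "(Num Std, Suc i) \<in> fv (subst ?\<rho> \<phi>)"
    by (auto simp: bounded_ex_def unbind_def)
  then show "i < Suc k"
  proof cases
    case 2
    then obtain s j where "(s, j) \<in> fv \<phi>" "(Num Std, Suc i) \<in> fv_tm (?\<rho> s j)"
      using fv_subst by blast
    \<comment> \<open>The renaming raises the positive indices by one and the bounded quantifier
      lowers them again, so index \<open>i\<close> is unchanged from \<open>\<phi>\<close>; seen
      from outside the quantifier of the given formula it is \<open>i - 1\<close>.\<close>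
    then have i: "(Num Std, i) \<in> fv \<phi>" "i > 0" by (auto split: if_splits)
    then have "(Num Std, i - 1) \<in> fv (Exists (Num Std) \<phi>)" by (simp add: unbind_def)
    then have "i - 1 < k" using assms unfolding std_args_def by blast
    then show ?thesis by simp
  qed simp
qed

text \<open>Inside the quantifier \<omega> has index \<open>1\<close>, which the renaming in
  \<open>bounded_ex\<close> skips. So \<omega> occurs only as the bound, and the body is the plain
  star image of \<open>\<phi>\<close>.\<close>

lemma at_omega_bounded_ex:
  assumes "delta0 Std \<phi>"
  shows "at_omega (bounded_ex \<phi>) = BEx Star (num Star 0) (star Std Star [num Star 0] \<phi>)"
proof -
  let ?\<rho> = "\<lambda>s i. if s = Num Std \<and> i > 0 then Var s (Suc i) else Var s i :: trm"
  let ?\<tau> = "\<lambda>s i. case s of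
        Num _ \<Rightarrow> if i < length [num Star 0] then [num Star 0] ! i
          else Emb Std Star (num Std (i - length [num Star 0]))
      | Sets _ \<Rightarrow> SEmb Std Star (sv Std i)"
  have "follows ?\<rho> (under (Num Star) ?\<tau>) ?\<tau>"
    unfolding follows_def
  proof (intro conjI allI)
    fix i
    show "\<exists>j. ?\<rho> (Num Std) i = num Std j \<and> ?\<tau> (Num Star) i = under (Num Star) ?\<tau> (Num Star) j"
      by (intro exI[of _ "if i > 0 then Suc i else i"])
        (auto simp: under_def shift_tm_def shift_env_def split: nat.split)
    show "\<exists>j. ?\<rho> (Sets Std) i = sv Std j \<and> ?\<tau> (Sets Star) i = under (Num Star) ?\<tau> (Sets Star) j"
      by (intro exI[of _ i]) (simp add: under_def shift_tm_def shift_env_def)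
  qed
  from subst_map_follows[OF this assms] show ?thesis
    by (simp add: at_omega_def star_def bounded_ex_def)
qed

section \<open>Infinite numbers\<close>

abbreviation omega_infinite :: form where
  "omega_infinite \<equiv> infinite_at Std Star (num Star 0)"

lemma finite_at_num:
  "l \<noteq> l' \<Longrightarrow> finite_at l l' (num l' i) = Exists (Num l) (Eq l' (num l' i) (Emb l l' (num l 0)))"
  by (simp add: finite_at_def shift_tm_def shift_env_def)

lemma shift_Std_omega_infinite: "shift (Num Std) omega_infinite = omega_infinite"
  by (simp add: finite_at_num shift_def under_def shift_env_def shift_tm_def)

text \<open>By trichotomy: \<omega> equal to a standard number is standard by definition, and
  \<omega> below one is standard by end extension.\<close>

lemma std_less_infinite:
  "{} \<turnstile> Imp omega_infinite (Less Star (Emb Std Star (num Std 0)) (num Star 0))"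
proof (rule ImpI)
  let ?n = "Emb Std Star (num Std 0)" and ?w = "num Star 0" and ?I = "{omega_infinite}"
  have srt: "has_srt ?n (Num Star)" by (simp add: below_def)
  have "{} \<turnstile> Or (Less Star (num Star 0) (num Star 1))
      (Or (Eq Star (num Star 0) (num Star 1)) (Less Star (num Star 1) (num Star 0)))"
    by (rule axiom) (simp only: NSA_axioms_def sNSA_axioms_def Un_iff ISigma1.intros simp_thms)
  from theorem_inst[OF this srt]
  have tri: "?I \<turnstile> Or (Less Star ?n ?w) (Or (Eq Star ?n ?w) (Less Star ?w ?n))"
    by (simp add: inst_def)
  have contra: "insert X (insert Y ?I) \<turnstile> Less Star ?n ?w"
    if "insert X (insert Y ?I) \<turnstile> finite_at Std Star ?w" for X Y
    by (rule FlsE, rule ImpE[OF _ that], rule hyp) simp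
  show "?I \<turnstile> Less Star ?n ?w"
  proof (rule OrE[OF tri])
    show "insert (Less Star ?n ?w) ?I \<turnstile> Less Star ?n ?w" by (rule hyp) simp
    let ?O = "Or (Eq Star ?n ?w) (Less Star ?w ?n)"
    show "insert ?O ?I \<turnstile> Less Star ?n ?w"
    proof (rule OrE)
      show "insert ?O ?I \<turnstile> ?O" by (rule hyp) simp
      have "insert (Eq Star ?n ?w) (insert ?O ?I) \<turnstile> Eq Star ?w ?n"
        by (rule Eq_sym, rule hyp) (simp_all add: below_def)
      then have "insert (Eq Star ?n ?w) (insert ?O ?I) \<turnstile> finite_at Std Star ?w"
        unfolding finite_at_num[OF level.distinct(3)]
        by (intro ExistsI[of _ _ "num Std 0"]) (simp_all add: inst_def)
      then show "insert (Eq Star ?n ?w) (insert ?O ?I) \<turnstile> Less Star ?n ?w" by (rule contra)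
      have "insert (Less Star ?w ?n) (insert ?O ?I) \<turnstile> end_extension Std Star"
        by (rule axiom) (simp add: NSA_axioms_def sNSA_axioms_def)
      then have "insert (Less Star ?w ?n) (insert ?O ?I) \<turnstile> finite_at Std Star ?w"
        unfolding end_extension_def by (rule ImpE) (rule hyp, simp)
      then show "insert (Less Star ?w ?n) (insert ?O ?I) \<turnstile> Less Star ?n ?w" by (rule contra)
    qed
  qed
qed

text \<open>A number outside the intermediate level is infinite: a standard number also lies in the
  intermediate level, because the embeddings compose.\<close>

lemma ex_infinite: "{} \<turnstile> Exists (Num Star) omega_infinite"
proof (rule ExistsE)
  let ?n = "num Std 0" and ?w = "num Star 0"
  let ?I = "{infinite_at Fin1 Star ?w}"
  show "{} \<turnstile> Exists (Num Star) (infinite_at Fin1 Star ?w)"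
    by (rule axiom) (simp add: NSA_axioms_def level_axioms_def)
  have "insert (finite_at Std Star ?w) ?I \<turnstile> finite_at Fin1 Star ?w" (is "?\<Delta> \<turnstile> _")
  proof (rule ExistsE)
    show "?\<Delta> \<turnstile> Exists (Num Std) (Eq Star ?w (Emb Std Star ?n))"
      by (rule hyp) (simp add: finite_at_num)
    let ?E = "insert (Eq Star ?w (Emb Std Star ?n)) (shift (Num Std) ` ?\<Delta>)"
    have "?E \<turnstile> Eq Star (Emb Fin1 Star (Emb Std Fin1 ?n)) (Emb Std Star ?n)"
      by (rule axiom) (simp add: NSA_axioms_def level_axioms_def)
    then have "?E \<turnstile> Eq Star (Emb Std Star ?n) (Emb Fin1 Star (Emb Std Fin1 ?n))"
      by (rule Eq_sym) (simp_all add: below_def)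
    then have "?E \<turnstile> Eq Star ?w (Emb Fin1 Star (Emb Std Fin1 ?n))"
      by (rule Eq_trans[rotated]) (auto simp: below_def intro: hyp)
    then have "?E \<turnstile> finite_at Fin1 Star ?w"
      unfolding finite_at_num[OF level.distinct(5)]
      by (intro ExistsI[of _ _ "Emb Std Fin1 ?n"]) (simp_all add: inst_def below_def)
    then show "?E \<turnstile> shift (Num Std) (finite_at Fin1 Star ?w)"
      by (simp add: finite_at_num shift_def shift_env_def under_def shift_tm_def)
  qed
  then have "insert (finite_at Std Star ?w) ?I \<turnstile> Fls"
    by (rule ImpE[rotated]) (rule hyp, simp)
  then have "?I \<turnstile> omega_infinite" by (rule ImpI)
  from Exists_of_body[OF this, of "Num Star"]
  show "insert (infinite_at Fin1 Star ?w) (shift (Num Star) ` {}) \<turnstile>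
      shift (Num Star) (Exists (Num Star) omega_infinite)" by simp
qed

section \<open>Transfer of existential formulas\<close>

text \<open>This direction holds in NSA alone: \<Delta>0-TRANS carries the standard witness to its
  star image, and the witness lies below \<omega>.\<close>

lemma ex_imp_bounded_ex:
  assumes "delta0 Std \<phi>"
  shows "{} \<turnstile> Imp omega_infinite (Imp (Exists (Num Std) \<phi>) (at_omega (bounded_ex \<phi>)))"
proof (intro ImpI)
  let ?P = "Exists (Num Std) \<phi>" and ?E = "at_omega (bounded_ex \<phi>)" and ?n = "Emb Std Star (num Std 0)"
  \<comment> \<open>The standard witness takes index \<open>0\<close> of its sort, so the star image
    is shifted on the standard variables, under the bound nonstandard one.\<close>
  let ?D = "subst (under (Num Star) (shift_env (Num Std))) (star Std Star [num Star 0] \<phi>)"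
  show "{?P, omega_infinite} \<turnstile> ?E"
  proof (rule ExistsE)
    show "{?P, omega_infinite} \<turnstile> ?P" by (rule hyp) simp
    let ?\<Delta> = "insert \<phi> (shift (Num Std) ` {?P, omega_infinite})"
    have "?\<Delta> \<turnstile> omega_infinite"
      by (rule hyp) (simp only: image_insert shift_Std_omega_infinite insert_iff simp_thms)
    then have less: "?\<Delta> \<turnstile> Less Star ?n (num Star 0)"
      by (rule ImpE[OF theorem_in_context[OF std_less_infinite]])
    have "?\<Delta> \<turnstile> Iff \<phi> (star Std Star [] \<phi>)"
      by (rule axiom) (use assms in \<open>auto simp: NSA_axioms_def sNSA_axioms_def Delta0_TRANS_def\<close>)
    then have "?\<Delta> \<turnstile> star Std Star [] \<phi>"
      by (rule ImpE[OF AndE1]) (rule hyp, simp)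
    \<comment> \<open>Inserting the embedded witness absorbs that shift: all number variables of
      \<open>\<phi>\<close> are now embedded with their own indices.\<close>
    moreover have "inst (Num Star) ?n ?D = star Std Star [] \<phi>"
      unfolding inst_def subst_subst
      by (rule subst_star[OF assms]) (auto simp: under_def shift_env_def shift_tm_def nth_Cons split: nat.split)
    ultimately have "?\<Delta> \<turnstile> inst (Num Star) ?n (And (Less Star (num Star 0) (num Star 1)) ?D)"
      using less by (auto simp: inst_def intro!: AndI)
    then have "?\<Delta> \<turnstile> Exists (Num Star) (And (Less Star (num Star 0) (num Star 1)) ?D)"
      by (rule ExistsI) (simp add: below_def)
    moreover have "?\<Delta> \<turnstile> Iff (BEx Star (num Star 0) ?D)
        (Exists (Num Star) (And (Less Star (num Star 0) (num Star 1)) ?D))"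
      using BEx_iff[of ?\<Delta> Star "num Star 0" ?D] by (simp add: shift_tm_def shift_env_def)
    ultimately have "?\<Delta> \<turnstile> BEx Star (num Star 0) ?D" using AndE2 ImpE by blast
    then show "?\<Delta> \<turnstile> shift (Num Std) ?E"
      by (simp add: at_omega_bounded_ex[OF assms] shift_def) (simp add: shift_env_def)
  qed
qed

lemma Forall_not_star_imp_not_bounded_ex:
  assumes "delta0 Std \<phi>" and "\<Gamma> \<turnstile> Forall (Num Star) (Neg (star Std Star [num Star 0] \<phi>))"
  shows "\<Gamma> \<turnstile> Neg (at_omega (bounded_ex \<phi>))"
proof (rule ImpI)
  let ?E = "at_omega (bounded_ex \<phi>)" and ?D = "star Std Star [num Star 0] \<phi>"
  let ?X = "Exists (Num Star) (And (Less Star (num Star 0) (num Star 1)) ?D)"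
  have "insert ?E \<Gamma> \<turnstile> Iff ?E ?X"
    using BEx_iff[of "insert ?E \<Gamma>" Star "num Star 0" ?D]
    by (simp add: shift_tm_def shift_env_def at_omega_bounded_ex[OF assms(1)])
  then have "insert ?E \<Gamma> \<turnstile> ?X" by (rule ImpE[OF AndE1]) (rule hyp, simp)
  moreover have "insert ?E \<Gamma> \<turnstile> Neg ?X"
    by (rule ImpE[OF theorem_in_context[OF Forall_not_imp_not_Exists_And]],
        rule weakening[OF assms(2)]) auto
  ultimately show "insert ?E \<Gamma> \<turnstile> Fls" by (rule ImpE[rotated])
qed

section \<open>Hyperconnectives\<close>

text \<open>No clause of \<open>transfers_to\<close> starts from a standard existential
  quantifier.\<close>

lemma in_T_sigma1: "in_T (Exists (Num Std) \<phi>) = triv"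
  by (auto simp: in_T_def elim: transfers_to.cases)

lemma in_T_absurd: "in_T absurd = triv"
  by (auto simp: in_T_def absurd_def elim: transfers_to.cases)

lemma hyper_neg_sigma1:
  "hyper_neg (Exists (Num Std) \<phi>) = Imp (And (Exists (Num Std) \<phi>) triv) (And absurd triv)"
  by (simp add: hyper_neg_def hyper_imp_def in_T_sigma1 in_T_absurd)

text \<open>\<open>shape\<close> reads the hypernegation as a universal formula with body
  \<open>Neg \<phi>\<close>. Only the first clause of \<open>transfers_to\<close> fits, since the
  third would need an existential body; this uniqueness evaluates the \<open>THE\<close> in
  \<open>in_T\<close>.\<close>

lemma in_T_hyper_neg_sigma1:
  assumes "delta0 Std \<phi>"
  shows "in_T (hyper_neg (Exists (Num Std) \<phi>)) =
    Imp (hyper_neg (Exists (Num Std) \<phi>)) (Forall (Num Star) (Neg (star Std Star [num Star 0] \<phi>)))"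
proof -
  have shape: "shape (hyper_neg (Exists (Num Std) \<phi>)) = Forall (Num Std) (Neg \<phi>)"
    using dual_delta0[OF assms] by (simp add: hyper_neg_sigma1 triv_def absurd_def)
  have "transfers_to (Forall (Num Std) (Neg \<phi>)) B \<longleftrightarrow>
      B = Forall (Num Star) (Neg (star Std Star [num Star 0] \<phi>))" for B
  proof
    show "transfers_to (Forall (Num Std) (Neg \<phi>)) B \<Longrightarrow>
        B = Forall (Num Star) (Neg (star Std Star [num Star 0] \<phi>))"
      by (cases rule: transfers_to.cases) (auto simp: star_Neg)
    show "B = Forall (Num Star) (Neg (star Std Star [num Star 0] \<phi>)) \<Longrightarrow>
        transfers_to (Forall (Num Std) (Neg \<phi>)) B"
      using transfers_to.intros(1)[of "Neg \<phi>"] assms by (simp add: star_Neg)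
  qed
  then have "transfers_to (Forall (Num Std) (Neg \<phi>)) =
      (\<lambda>B. B = Forall (Num Star) (Neg (star Std Star [num Star 0] \<phi>)))" by blast
  then show ?thesis by (simp add: in_T_def shape)
qed

text \<open>In \<open>decides\<close> both alternatives stand under the quantifier for \<omega>.
  This and the following equations show that they are insensitive to it.\<close>

lemma shift_Star_delta0: "delta0 Std \<phi> \<Longrightarrow> subst (under (Num Std) (shift_env (Num Star))) \<phi> = \<phi>"
  by (rule subst_id)
    (auto simp: under_def shift_env_def shift_tm_def dest: fv_delta0 split: nat.split)

lemma subst_under_Star_star:
  assumes "delta0 Std \<phi>"
  shows "subst (under (Num Star) (shift_env (Num Star))) (star Std Star [num Star 0] \<phi>)
    = star Std Star [num Star 0] \<phi>"
  by (rule subst_star[OF assms]) (auto simp: under_def shift_env_def shift_tm_def)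

lemma shift_Star_sigma1: "delta0 Std \<phi> \<Longrightarrow> shift (Num Star) (Exists (Num Std) \<phi>) = Exists (Num Std) \<phi>"
  by (simp add: shift_def shift_Star_delta0)

lemma shift_Star_Forall_star:
  "delta0 Std \<phi> \<Longrightarrow> shift (Num Star) (Forall (Num Star) (star Std Star [num Star 0] \<phi>))
     = Forall (Num Star) (star Std Star [num Star 0] \<phi>)"
  by (simp add: shift_def subst_under_Star_star)

lemma shift_Star_hyper_neg_sigma1:
  "delta0 Std \<phi> \<Longrightarrow> shift (Num Star) (hyper_neg (Exists (Num Std) \<phi>)) = hyper_neg (Exists (Num Std) \<phi>)"
  by (simp add: hyper_neg_sigma1 shift_def shift_Star_delta0 triv_def absurd_def)

lemma shift_Star_holds_in_T_hyper_neg_sigma1: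
  assumes "delta0 Std \<phi>"
  shows "shift (Num Star) (And (hyper_neg (Exists (Num Std) \<phi>)) (in_T (hyper_neg (Exists (Num Std) \<phi>)))) =
    And (hyper_neg (Exists (Num Std) \<phi>)) (Imp (hyper_neg (Exists (Num Std) \<phi>))
      (Forall (Num Star) (Neg (star Std Star [num Star 0] \<phi>))))"
  using shift_Star_hyper_neg_sigma1[OF assms] assms
  by (simp add: in_T_hyper_neg_sigma1 shift_def subst_under_Star_star)

lemma shift_Star_holds_in_T_sigma1:
  assumes "delta0 Std \<phi>"
  shows "shift (Num Star) (And (Exists (Num Std) \<phi>) (in_T (Exists (Num Std) \<phi>))) =
    And (Exists (Num Std) \<phi>) triv"
  using shift_Star_sigma1[OF assms] by (simp add: in_T_sigma1 shift_def triv_def)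

section \<open>The equivalence\<close>

text \<open>Only one direction needs transfer: if the existential formula fails, \<Pi>1-TRANS for
  \<open>Neg \<phi>\<close> refutes \<open>\<phi>\<close> at all nonstandard numbers, in particular
  below \<omega>.\<close>

lemma Pi1_TRANS_imp_bounded_ex_iff:
  assumes "Pi1_TRANS \<Gamma>" and "delta0 Std \<phi>"
  shows "\<Gamma> \<turnstile> Imp omega_infinite (Iff (at_omega (bounded_ex \<phi>)) (Exists (Num Std) \<phi>))"
proof (rule ImpI, rule AndI)
  let ?P = "Exists (Num Std) \<phi>" and ?E = "at_omega (bounded_ex \<phi>)"
  let ?\<Delta> = "insert omega_infinite \<Gamma>"
  show "?\<Delta> \<turnstile> Imp ?P ?E"
    by (rule ImpE[OF theorem_in_context[OF ex_imp_bounded_ex[OF assms(2)]]], rule hyp) simp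
  show "?\<Delta> \<turnstile> Imp ?E ?P"
  proof (rule ImpI, rule classical)
    let ?\<Theta> = "insert (Neg ?P) (insert ?E ?\<Delta>)"
    have "\<Gamma> \<turnstile> Imp (Forall (Num Std) (Neg \<phi>)) (Forall (Num Star) (Neg (star Std Star [num Star 0] \<phi>)))"
      using assms unfolding Pi1_TRANS_def by (metis delta0.simps(1,5) star_Neg)
    then have trans: "?\<Theta> \<turnstile> Imp (Forall (Num Std) (Neg \<phi>)) (Forall (Num Star) (Neg (star Std Star [num Star 0] \<phi>)))"
      by (rule weakening) auto
    have "?\<Theta> \<turnstile> Forall (Num Std) (Neg \<phi>)"
      by (rule ImpE[OF theorem_in_context[OF not_Exists_imp_Forall_not]], rule hyp) simp
    then have "?\<Theta> \<turnstile> Neg ?E"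
      using Forall_not_star_imp_not_bounded_ex[OF assms(2)] ImpE[OF trans] by blast
    then show "?\<Theta> \<turnstile> Fls" by (rule ImpE) (rule hyp, simp)
  qed
qed

lemma Pi1_TRANS_imp_LPO:
  assumes sent: "\<forall>A\<in>\<Gamma>. sentence A" and trans: "Pi1_TRANS \<Gamma>"
  shows "LPO \<Gamma>"
  unfolding LPO_def
proof (intro allI impI)
  fix k P
  assume "sigma1 Std P \<and> std_args k P"
  then obtain \<phi> where \<phi>: "delta0 Std \<phi>" and P: "P = Exists (Num Std) \<phi>" and k: "std_args k P"
    unfolding sigma1_def by blast
  let ?\<psi> = "bounded_ex \<phi>" and ?I = omega_infinite
  let ?E = "at_omega ?\<psi>" and ?N = "hyper_neg P"
  let ?T = "Forall (Num Star) (Neg (star Std Star [num Star 0] \<phi>))"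
  let ?\<Delta> = "insert ?I \<Gamma>"
  have std: "shift (Num Std) ` ?\<Delta> = ?\<Delta>"
    using image_shift_sentences[OF sent] by (simp only: image_insert shift_Std_omega_infinite)
  have iff: "\<Gamma> \<turnstile> Imp ?I (Iff ?E P)"
    unfolding P by (rule Pi1_TRANS_imp_bounded_ex_iff[OF trans \<phi>])
  have iff_I: "\<Theta> \<turnstile> Iff ?E P" if "?I \<in> \<Theta>" "\<Gamma> \<subseteq> \<Theta>" for \<Theta>
    by (rule ImpE[OF weakening[OF iff that(2)]], rule hyp, rule that)
  \<comment> \<open>Instantiating \<omega> by \<open>num Star 1\<close> agrees with a shift here,
    since index \<open>0\<close> is the only free nonstandard number variable. This yields the
    equivalence for a second infinite number.\<close>
  have inst_I: "inst (Num Star) (num Star 1) ?I = shift (Num Star) ?I"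
    by (simp add: finite_at_num inst_def shift_def under_def shift_env_def shift_tm_def)
  have inst_P: "inst (Num Star) (num Star 1) P = P"
    unfolding inst_def
    by (rule subst_id) (auto simp: P unbind_def dest: fv_delta0[OF \<phi>])
  have "subst (under (Num Star) (\<lambda>s' i. if s' = Num Star
        then (case i of 0 \<Rightarrow> num Star (Suc 0) | Suc j \<Rightarrow> num Star j) else Var s' i))
      (star Std Star [num Star 0] \<phi>) = star Std Star [num Star 0] \<phi>"
    by (rule subst_star[OF \<phi>]) (auto simp: under_def shift_tm_def shift_env_def)
  then have inst_E: "inst (Num Star) (num Star 1) ?E = shift (Num Star) ?E"
    by (simp add: at_omega_bounded_ex[OF \<phi>] inst_def shift_def subst_under_Star_star[OF \<phi>])
      (simp add: shift_env_def)
  have "\<Gamma> \<turnstile> inst (Num Star) (num Star 1) (Imp ?I (Iff ?E P))"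
    by (rule sentences_inst[OF sent iff]) simp
  then have iff': "\<Gamma> \<turnstile> Imp (shift (Num Star) ?I) (Iff (shift (Num Star) ?E) P)"
    using inst_I inst_P inst_E by (simp add: inst_def)
  have inv: "?\<Delta> \<turnstile> Omega_invariant k ?\<psi>"
    unfolding Omega_invariant_def
  proof (rule ForallsI[OF std], rule ForallI, rule ImpI)
    \<comment> \<open>Index \<open>0\<close> is now \<omega>' and index \<open>1\<close> is
      \<omega>. Both are infinite, so both values are equivalent to \<open>P\<close>.\<close>
    let ?\<Theta> = "insert ?I (shift (Num Star) ` ?\<Delta>)"
    have sub: "\<Gamma> \<subseteq> ?\<Theta>" using image_shift_sentences[OF sent] by auto
    have "?\<Theta> \<turnstile> Iff (shift (Num Star) ?E) P"
      by (rule ImpE[OF weakening[OF iff' sub]], rule hyp) blast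
    moreover have "?\<Theta> \<turnstile> Iff ?E P" by (rule iff_I[OF _ sub]) simp
    ultimately show "?\<Theta> \<turnstile> Iff (shift (Num Star) ?E) ?E" by (rule Iff_trans)
  qed
  have pos: "?\<Delta> \<turnstile> Imp ?E (And P triv)"
  proof (intro ImpI AndI)
    show "insert ?E ?\<Delta> \<turnstile> P" by (rule ImpE[OF AndE1[OF iff_I]]) (auto intro: hyp)
    show "insert ?E ?\<Delta> \<turnstile> triv" unfolding triv_def by (rule Eq_refl) simp
  qed
  have neg: "?\<Delta> \<turnstile> Imp (Neg ?E) (And ?N (Imp ?N ?T))"
  proof (rule ImpI)
    let ?\<Theta> = "insert (Neg ?E) ?\<Delta>"
    have notP: "?\<Theta> \<turnstile> Neg P"
    proof (rule ImpI)
      have "insert P ?\<Theta> \<turnstile> ?E" by (rule ImpE[OF AndE2[OF iff_I]]) (auto intro: hyp)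
      then show "insert P ?\<Theta> \<turnstile> Fls" by (rule ImpE[rotated]) (rule hyp, simp)
    qed
    have "insert (And P triv) ?\<Theta> \<turnstile> Neg P" by (rule weakening[OF notP]) auto
    moreover have "insert (And P triv) ?\<Theta> \<turnstile> P" by (rule AndE1, rule hyp, rule insertI1)
    ultimately have "insert (And P triv) ?\<Theta> \<turnstile> And absurd triv" by (blast intro: FlsE ImpE)
    then have N: "?\<Theta> \<turnstile> ?N" unfolding P hyper_neg_sigma1 by (rule ImpI)
    have "?\<Theta> \<turnstile> Forall (Num Std) (Neg \<phi>)"
      using ImpE[OF theorem_in_context[OF not_Exists_imp_Forall_not] notP[unfolded P]] unfolding P .
    moreover have "\<Gamma> \<turnstile> Imp (Forall (Num Std) (Neg \<phi>)) ?T"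
      using trans \<phi> unfolding Pi1_TRANS_def by (metis delta0.simps(1,5) star_Neg)
    then have "?\<Theta> \<turnstile> Imp (Forall (Num Std) (Neg \<phi>)) ?T" by (rule weakening) auto
    ultimately have "?\<Theta> \<turnstile> ?T" by (rule ImpE[rotated])
    then have "?\<Theta> \<turnstile> Imp ?N ?T" by (intro ImpI) (rule weakening, auto)
    with N show "?\<Theta> \<turnstile> And ?N (Imp ?N ?T)" by (rule AndI)
  qed
  have body: "?\<Delta> \<turnstile> And ?I (And (Omega_invariant k ?\<psi>)
      (Foralls k (And (Imp ?E (shift (Num Star) (And P (in_T P))))
        (Imp (Neg ?E) (shift (Num Star) (And ?N (in_T ?N)))))))"
    unfolding P shift_Star_holds_in_T_sigma1[OF \<phi>] shift_Star_holds_in_T_hyper_neg_sigma1[OF \<phi>]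
    unfolding P[symmetric]
    by (intro AndI inv ForallsI[OF std] pos neg) (rule hyp, simp)
  \<comment> \<open>The body was derived from the infinity of \<omega> alone, so any infinite number
    is a witness.\<close>
  have "\<Gamma> \<turnstile> decides k ?\<psi> P ?N"
  proof (rule ExistsE[OF theorem_in_context[OF ex_infinite]])
    show "insert ?I (shift (Num Star) ` \<Gamma>) \<turnstile> shift (Num Star) (decides k ?\<psi> P ?N)"
      using Exists_of_body[OF body, of "Num Star"]
      unfolding decides_def image_shift_sentences[OF sent] .
  qed
  then show "oplus \<Gamma> k P (hyper_neg P)"
    unfolding oplus_def using delta0_bounded_ex[OF \<phi>] std_args_bounded_ex k P by blast
qed

text \<open>This licenses \<open>Foralls_body\<close> for the quantifier block in
  \<open>decides\<close>.\<close>

lemma std_args_decision: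
  assumes \<phi>: "delta0 Std \<phi>" and \<psi>: "delta0 Std \<psi>" "std_args (Suc k) \<psi>"
    and P: "std_args k (Exists (Num Std) \<phi>)"
  shows "std_args k (And (Imp (at_omega \<psi>) (And (Exists (Num Std) \<phi>) triv))
    (Imp (Neg (at_omega \<psi>)) (And (hyper_neg (Exists (Num Std) \<phi>)) (Imp (hyper_neg (Exists (Num Std) \<phi>))
      (Forall (Num Star) (Neg (star Std Star [num Star 0] \<phi>)))))))"
proof -
  have "i < k" if "(Num Std, i) \<in> fv (at_omega \<psi>)" for i
    using fv_star[OF \<psi>(1)] that \<psi>(2) unfolding at_omega_def std_args_def by fastforce
  moreover have "i < k" if "(Num Std, Suc i) \<in> fv \<phi>" for i
    using P that by (auto simp: std_args_def unbind_def)
  ultimately show ?thesis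
    using fv_star[OF \<phi>] by (auto simp: std_args_def unbind_def hyper_neg_sigma1 triv_def absurd_def)
qed

lemma LPO_imp_Pi1_TRANS:
  assumes "LPO \<Gamma>"
  shows "Pi1_TRANS \<Gamma>"
  unfolding Pi1_TRANS_def
proof (intro allI impI)
  fix \<phi>
  assume \<phi>: "delta0 Std \<phi>"
  let ?P = "Exists (Num Std) (Neg \<phi>)" and ?A = "Forall (Num Std) \<phi>"
  let ?N = "hyper_neg ?P" and ?D = "star Std Star [num Star 0] \<phi>"
  have n\<phi>: "delta0 Std (Neg \<phi>)" using \<phi> by simp
  \<comment> \<open>\<open>\<phi>\<close> comes without a bound on its parameters; finiteness of the
    free variables supplies the arity.\<close>
  obtain k where k: "std_args k ?P" using ex_std_args by blast
  moreover have "sigma1 Std ?P" unfolding sigma1_def using n\<phi> by blast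
  ultimately obtain \<psi> where \<psi>: "delta0 Std \<psi>" "std_args (Suc k) \<psi>"
    and dec: "\<Gamma> \<turnstile> decides k \<psi> ?P ?N"
    using assms unfolding LPO_def oplus_def by blast
  let ?E = "at_omega \<psi>" and ?T = "Forall (Num Star) (Neg (star Std Star [num Star 0] (Neg \<phi>)))"
  let ?C = "And (Imp ?E (And ?P triv)) (Imp (Neg ?E) (And ?N (Imp ?N ?T)))"
  let ?B = "And omega_infinite (And (Omega_invariant k \<psi>) (Foralls k ?C))"
  have decides: "decides k \<psi> ?P ?N = Exists (Num Star) ?B"
    unfolding decides_def shift_Star_holds_in_T_sigma1[OF n\<phi>]
      shift_Star_holds_in_T_hyper_neg_sigma1[OF n\<phi>] ..
  show "\<Gamma> \<turnstile> Imp ?A (Forall (Num Star) ?D)"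
  proof (rule ImpI, rule ExistsE)
    show "insert ?A \<Gamma> \<turnstile> Exists (Num Star) ?B"
      by (rule weakening[OF dec[unfolded decides]]) auto
    let ?\<Delta> = "insert ?B (shift (Num Star) ` insert ?A \<Gamma>)"
    have "?\<Delta> \<turnstile> Foralls k ?C" by (rule AndE2[OF AndE2], rule hyp, rule insertI1)
    then have C: "?\<Delta> \<turnstile> ?C" by (rule Foralls_body) (rule std_args_decision[OF n\<phi> \<psi> k])
    have "shift (Num Star) ?A = ?A" by (simp add: shift_def shift_Star_delta0[OF \<phi>])
    then have "?\<Delta> \<turnstile> ?A" by (intro hyp) (metis image_eqI insertCI)
    then have notP: "?\<Delta> \<turnstile> Neg ?P" by (rule ImpE[OF theorem_in_context[OF Forall_imp_not_Exists_not]])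
    have "?\<Delta> \<turnstile> Neg ?E"
    proof (rule ImpI)
      have "insert ?E ?\<Delta> \<turnstile> Imp ?E (And ?P triv)" by (rule weakening[OF AndE1[OF C]]) auto
      then have "insert ?E ?\<Delta> \<turnstile> And ?P triv" by (rule ImpE) (rule hyp, rule insertI1)
      moreover have "insert ?E ?\<Delta> \<turnstile> Neg ?P" by (rule weakening[OF notP]) auto
      ultimately show "insert ?E ?\<Delta> \<turnstile> Fls" using AndE1 ImpE by blast
    qed
    then have "?\<Delta> \<turnstile> And ?N (Imp ?N ?T)" by (rule ImpE[OF AndE2[OF C]])
    then have "?\<Delta> \<turnstile> ?T" using AndE1 AndE2 ImpE by blast
    \<comment> \<open>The second alternative negates the star image of \<open>Neg \<phi>\<close>, so
      a double negation is removed under the quantifier.\<close>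
    then have "?\<Delta> \<turnstile> Forall (Num Star) ?D"
      unfolding star_Neg by (rule Forall_mono[OF double_negation])
    then show "?\<Delta> \<turnstile> shift (Num Star) (Forall (Num Star) ?D)"
      by (simp only: shift_Star_Forall_star[OF \<phi>])
  qed
qed

theorem mainTheorem2:
  fixes \<Gamma> :: "form set"
  assumes "\<forall>A\<in>\<Gamma>. sentence A"
  shows "LPO \<Gamma> \<longleftrightarrow> Pi1_TRANS \<Gamma>"
  using LPO_imp_Pi1_TRANS Pi1_TRANS_imp_LPO[OF assms] by blast

end
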